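(* Let $p\in(0,1)$ be a fixed constant and $\beta\ge0$ a fixed real number. For an even integer $n=2s$, let $M$ be the $n\times n$ matrix with $m_{ij}=p$ if $1\le|i-j|\le s-1$ and $0$ otherwise, and let $\widehat M$ be a random symmetric $n\times n$ matrix with zero diagonal whose entries $\widehat m_{ij}$, $i<j$, are independent Bernoulli variables with $\mathbb P(\widehat m_{ij}=1)=m_{ij}$. Let $u\in\mathbb R^n$ be given by $u_j=\cos\left(\frac{(2j-1)\pi}{4s+2}\right)$ for $j=1,\dots,s$ and $u_j=-u_{n-j+1}$ for $j=s+1,\dots,n$, and let $y$ be a unit eigenvector of $\widehat M$ for $\lambda_2(\widehat M)$ with sign chosen so that $\langle y,u\rangle\ge0$. Let $k=n^{\beta}$. Then there is a constant $C>0$ (independent of $n$) such that, with probability at least $1-n^{-3}$, \[ D_{k,1}(y)<Cn^{\frac{7-2\beta}{3}}. \]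
   Context: Eigenvalues of a symmetric matrix $X$ are labelled so that $|\lambda_1(X)|\ge|\lambda_2(X)|\ge\dots$; $\lambda_2(X)$ is the one of second largest absolute value. For $y\in\mathbb R^n$ and reals $k,r$, \[ D_{k,r}(y)=\left|\{(i,j): y_j>y_i,\ i+k\le j,\ r\le i\}\right|. \] *)

theory Defs
  imports "HOL-Probability.Probability"
begin

text \<open>Vectors in R^n are functions nat => real, relevant on indices 1..n;
  n x n matrices are functions nat => nat => real, relevant on 1..n x 1..n.\<close>

definition is_eigvec :: "nat \<Rightarrow> (nat \<Rightarrow> nat \<Rightarrow> real) \<Rightarrow> real \<Rightarrow> (nat \<Rightarrow> real) \<Rightarrow> bool" where
  "is_eigvec n A lam y \<longleftrightarrow> (\<forall>i\<in>{1..n}. (\<Sum>j=1..n. A i j * y j) = lam * y i)"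

text \<open>lam is lambda_2(A): the second entry of a labelling ev 1, ..., ev n of the eigenvalues
  of A (with multiplicity, realised by an orthonormal eigenbasis) sorted so that
  |ev 1| >= |ev 2| >= ... >= |ev n|.\<close>
definition second_eigenvalue :: "nat \<Rightarrow> (nat \<Rightarrow> nat \<Rightarrow> real) \<Rightarrow> real \<Rightarrow> bool" where
  "second_eigenvalue n A lam \<longleftrightarrow>
     (\<exists>ev :: nat \<Rightarrow> real. \<exists>v :: nat \<Rightarrow> nat \<Rightarrow> real.
        (\<forall>l\<in>{1..n}. is_eigvec n A (ev l) (v l)) \<and>
        (\<forall>l\<in>{1..n}. \<forall>l'\<in>{1..n}. (\<Sum>i=1..n. v l i * v l' i) = (if l = l' then 1 else 0)) \<and>
        (\<forall>l\<in>{1..n}. \<forall>l'\<in>{1..n}. l \<le> l' \<longrightarrow> \<bar>ev l'\<bar> \<le> \<bar>ev l\<bar>) \<and>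
        lam = ev 2)"

definition bandM :: "nat \<Rightarrow> real \<Rightarrow> nat \<Rightarrow> nat \<Rightarrow> real" where
  "bandM s p i j = (if 1 \<le> \<bar>int i - int j\<bar> \<and> \<bar>int i - int j\<bar> \<le> int s - 1 then p else 0)"

definition rand_sym :: "nat \<Rightarrow> (nat \<Rightarrow> nat \<Rightarrow> real) \<Rightarrow> (nat \<Rightarrow> nat \<Rightarrow> real) pmf" where
  "rand_sym n P = map_pmf
     (\<lambda>X i j. if i < j then (if X (i, j) then 1 else 0)
              else if j < i then (if X (j, i) then 1 else 0) else 0)
     (Pi_pmf {(i, j). 1 \<le> i \<and> i < j \<and> j \<le> n} False (\<lambda>(i, j). bernoulli_pmf (P i j)))"

definition u_vec :: "nat \<Rightarrow> nat \<Rightarrow> real" where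
  "u_vec s j = (if j \<le> s then cos ((2 * real j - 1) * pi / (4 * real s + 2))
                else - cos ((2 * real (2 * s - j + 1) - 1) * pi / (4 * real s + 2)))"

definition D_count :: "nat \<Rightarrow> real \<Rightarrow> real \<Rightarrow> (nat \<Rightarrow> real) \<Rightarrow> nat" where
  "D_count n k r y = card {(i, j). i \<in> {1..n} \<and> j \<in> {1..n} \<and> y j > y i \<and>
                                   real i + k \<le> real j \<and> r \<le> real i}"

end

theory Submission
  imports Defs "HOL-Real_Asymp.Real_Asymp"
begin

text \<open>Write n = 2s and let u be normalised. The expected matrix has u as an eigenvector, and up to O(1)
  it is \<open>p (3 s / 2) e e' + p mu u u'\<close> plus a remainder, where e is the normalised all-ones vector and
  mu is asymptotically \<open>2 s / pi\<close>. The Frobenius norm of the remainder is below \<open>0.591 p s\<close>, which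
  already separates the second eigenvalue from the rest. The noise E is shown to have small operator norm
  through the Frobenius norm of its square, whose entries are controlled by Hoeffding's inequality, and
  E u is shown to have norm O(sqrt n). A Davis-Kahan argument gives \<open>norm (y - u) = O(1 / sqrt n)\<close>.

  An inverted pair (i, j) forces \<open>\<bar>y i - u i\<bar>\<close> or \<open>\<bar>y j - u j\<bar>\<close> to be at least half of \<open>u i - u j\<close>. For
  pairs at distance r from both ends this gap is of order \<open>k r / n powr (5 / 2)\<close>, so Chebyshev's inequality
  leaves \<open>O(n\<^sup>4 / (k r)\<^sup>2)\<close> bad indices, hence \<open>O(n\<^sup>5 / (k r)\<^sup>2)\<close> pairs, while the pairs near the
  ends number O(n r). The choice \<open>r = n powr ((4 - 2 * \<beta>) / 3)\<close> balances the two.\<close>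

section \<open>Perturbation of the second eigenvector\<close>

text \<open>Apart from \<open>u\<close>, no eigenvector of the expected matrix is computed. For
  large s the vector e is not an eigenvector; what is removed along it is its Rayleigh quotient, and
  the rest is controlled by its Frobenius norm alone. In units of p s that norm tends to sqrt (3/4 -
  4/pi^2), about 0.587, against 2/pi, about 0.637, for the second eigenvalue. The gap is thin but of
  order s, hence the explicit decimals and the threshold 500 for s.

  The noise enters twice, with different precision. Its operator norm only has to keep this gap
  open, so a small multiple of n suffices. The Frobenius norm of the noise itself is of order n with
  a constant that may be too large; in its square, however, the off-diagonal entries are sums of
  independent centred products, and the diagonal contributes at most n^3 where order n^4 is allowed.
  The rate 1 / sqrt n comes solely from the noise applied to u: as u is an exact eigenvector of the
  expected matrix, the error of u as an approximate eigenvector is noise only, and u is one fixed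
  vector, so a tail bound for a single vector is enough.\<close>

definition dotp :: "nat \<Rightarrow> (nat \<Rightarrow> real) \<Rightarrow> (nat \<Rightarrow> real) \<Rightarrow> real" where
  "dotp n x y = (\<Sum>i=1..n. x i * y i)"

definition mulv :: "nat \<Rightarrow> (nat \<Rightarrow> nat \<Rightarrow> real) \<Rightarrow> (nat \<Rightarrow> real) \<Rightarrow> nat \<Rightarrow> real" where
  "mulv n A x i = (\<Sum>j=1..n. A i j * x j)"

lemma dotp_commute: "dotp n x y = dotp n y x"
  by (simp add: dotp_def mult.commute)

lemma dotp_self: "dotp n x x = (\<Sum>i=1..n. (x i)\<^sup>2)"
  by (simp add: dotp_def power2_eq_square)

lemma dotp_nonneg [simp]: "0 \<le> dotp n x x"
  by (simp add: dotp_self sum_nonneg)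

lemma dotp_cong: "(\<And>i. i \<in> {1..n} \<Longrightarrow> x i = x' i) \<Longrightarrow> (\<And>i. i \<in> {1..n} \<Longrightarrow> y i = y' i)
    \<Longrightarrow> dotp n x y = dotp n x' y'"
  by (simp add: dotp_def)

lemma dotp_add_left: "dotp n (\<lambda>i. x i + y i) z = dotp n x z + dotp n y z"
  and dotp_add_right: "dotp n z (\<lambda>i. x i + y i) = dotp n z x + dotp n z y"
  and dotp_diff_left: "dotp n (\<lambda>i. x i - y i) z = dotp n x z - dotp n y z"
  and dotp_diff_right: "dotp n z (\<lambda>i. x i - y i) = dotp n z x - dotp n z y"
  and dotp_scale_left: "dotp n (\<lambda>i. c * x i) z = c * dotp n x z"
  and dotp_scale_right: "dotp n z (\<lambda>i. c * x i) = c * dotp n z x"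
  by (simp_all add: dotp_def sum.distrib sum_subtractf sum_distrib_left algebra_simps)

lemma dotp_sum_left: "dotp n (\<lambda>i. \<Sum>l\<in>L. c l * x l i) z = (\<Sum>l\<in>L. c l * dotp n (x l) z)"
proof -
  have "dotp n (\<lambda>i. \<Sum>l\<in>L. c l * x l i) z = (\<Sum>i=1..n. \<Sum>l\<in>L. c l * (x l i * z i))"
    by (simp add: dotp_def sum_distrib_right mult.assoc)
  also have "\<dots> = (\<Sum>l\<in>L. c l * dotp n (x l) z)"
    by (subst sum.swap) (simp add: dotp_def sum_distrib_left)
  finally show ?thesis .
qed

lemmas dotp_simps = dotp_add_left dotp_add_right dotp_diff_left dotp_diff_right
  dotp_scale_left dotp_scale_right

lemma dotp_Cauchy_Schwarz: "(dotp n x y)\<^sup>2 \<le> dotp n x x * dotp n y y"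
  unfolding dotp_self unfolding dotp_def by (rule Cauchy_Schwarz_ineq_sum)

lemma dotp_mulv_sym:
  assumes "\<And>i j. A i j = A j i"
  shows "dotp n x (mulv n A y) = dotp n (mulv n A x) y"
proof -
  have "dotp n x (mulv n A y) = (\<Sum>i=1..n. \<Sum>j=1..n. x i * (A i j * y j))"
    by (simp add: dotp_def mulv_def sum_distrib_left)
  also have "\<dots> = (\<Sum>j=1..n. \<Sum>i=1..n. A j i * x i * y j)"
    by (subst sum.swap) (auto intro!: sum.cong simp: assms[of j i for i j])
  also have "\<dots> = dotp n (mulv n A x) y"
    by (simp add: dotp_def mulv_def sum_distrib_right)
  finally show ?thesis .
qed

section \<open>Orthonormal systems of n vectors: Bessel, completeness, Parseval\<close>

locale orthonormal_basis =
  fixes n :: nat and v :: "nat \<Rightarrow> nat \<Rightarrow> real"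
  assumes orth: "l \<in> {1..n} \<Longrightarrow> l' \<in> {1..n} \<Longrightarrow> dotp n (v l) (v l') = (if l = l' then 1 else 0)"
begin

lemma residual:
  "dotp n (\<lambda>i. x i - (\<Sum>l=1..n. dotp n (v l) x * v l i)) (\<lambda>i. x i - (\<Sum>l=1..n. dotp n (v l) x * v l i))
     = dotp n x x - (\<Sum>l=1..n. (dotp n (v l) x)\<^sup>2)"
proof -
  define p where "p = (\<lambda>i. \<Sum>l=1..n. dotp n (v l) x * v l i)"
  have px: "dotp n p x = (\<Sum>l=1..n. (dotp n (v l) x)\<^sup>2)"
    unfolding p_def by (subst dotp_sum_left) (simp add: power2_eq_square)
  have vp: "dotp n p (v l) = dotp n (v l) x" if "l \<in> {1..n}" for l
  proof -
    have "dotp n p (v l) = (\<Sum>l'=1..n. dotp n (v l') x * dotp n (v l') (v l))"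
      unfolding p_def by (rule dotp_sum_left)
    also have "\<dots> = (\<Sum>l'=1..n. if l' = l then dotp n (v l) x else 0)"
      by (rule sum.cong) (use that in \<open>simp_all add: orth\<close>)
    also have "\<dots> = dotp n (v l) x" using that by simp
    finally show ?thesis .
  qed
  have "dotp n p p = (\<Sum>l=1..n. dotp n (v l) x * dotp n (v l) p)"
    by (subst (1) p_def) (rule dotp_sum_left)
  also have "\<dots> = (\<Sum>l=1..n. (dotp n (v l) x)\<^sup>2)"
    by (intro sum.cong) (simp_all add: dotp_commute[of n _ p] vp power2_eq_square)
  finally have pp: "dotp n p p = (\<Sum>l=1..n. (dotp n (v l) x)\<^sup>2)" .
  have "dotp n (\<lambda>i. x i - p i) (\<lambda>i. x i - p i) = dotp n x x - (\<Sum>l=1..n. (dotp n (v l) x)\<^sup>2)"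
    by (simp add: dotp_simps pp px dotp_commute[of n x p])
  then show ?thesis by (simp add: p_def)
qed

lemma bessel: "(\<Sum>l=1..n. (dotp n (v l) x)\<^sup>2) \<le> dotp n x x"
  using residual[of x] dotp_nonneg[of n "\<lambda>i. x i - (\<Sum>l=1..n. dotp n (v l) x * v l i)"] by linarith

text \<open>Summed over the n standard basis vectors, both sides of Bessel's inequality equal n, so it is
  an equality for each of them.\<close>
lemma complete:
  assumes "i \<in> {1..n}" "j \<in> {1..n}"
  shows "(\<Sum>l=1..n. v l i * v l j) = (if i = j then 1 else 0)"
proof -
  define b :: "nat \<Rightarrow> nat \<Rightarrow> real" where "b = (\<lambda>i j. if i = j then 1 else 0)"
  have vb: "dotp n (v l) (b i) = v l i" if "i \<in> {1..n}" for l i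
    using that by (simp add: dotp_def b_def if_distrib cong: if_cong)
  have bb: "dotp n (b i) (b i) = 1" if "i \<in> {1..n}" for i
    using that by (simp add: dotp_def b_def if_distrib cong: if_cong)
  have le: "(\<Sum>l=1..n. (v l i)\<^sup>2) \<le> 1" if "i \<in> {1..n}" for i
    using bessel[of "b i"] that by (simp add: vb bb)
  have "(\<Sum>i=1..n. 1 - (\<Sum>l=1..n. (v l i)\<^sup>2)) = real n - (\<Sum>l=1..n. dotp n (v l) (v l))"
    by (subst sum_subtractf, subst sum.swap) (simp add: dotp_self)
  also have "\<dots> = 0" by (simp add: orth)
  finally have "1 - (\<Sum>l=1..n. (v l i)\<^sup>2) = 0"
    using sum_nonneg_eq_0_iff[of "{1..n}" "\<lambda>i. 1 - (\<Sum>l=1..n. (v l i)\<^sup>2)"] le assms(1) by auto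
  then have "dotp n (\<lambda>j. b i j - (\<Sum>l=1..n. v l i * v l j)) (\<lambda>j. b i j - (\<Sum>l=1..n. v l i * v l j)) = 0"
    using residual[of "b i"] assms(1) by (simp add: vb bb)
  then have "(\<Sum>j=1..n. (b i j - (\<Sum>l=1..n. v l i * v l j))\<^sup>2) = 0"
    by (simp add: dotp_self)
  then have "b i j - (\<Sum>l=1..n. v l i * v l j) = 0"
    using sum_nonneg_eq_0_iff[of "{1..n}" "\<lambda>j. (b i j - (\<Sum>l=1..n. v l i * v l j))\<^sup>2"] assms(2) by auto
  then show ?thesis by (simp add: b_def)
qed

lemma parseval: "dotp n x y = (\<Sum>l=1..n. dotp n (v l) x * dotp n (v l) y)"
proof -
  have "(\<Sum>l=1..n. dotp n (v l) x * dotp n (v l) y)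
      = (\<Sum>l=1..n. \<Sum>i=1..n. \<Sum>j=1..n. x i * y j * (v l i * v l j))"
    by (simp add: dotp_def sum_product mult_ac)
  also have "\<dots> = (\<Sum>i=1..n. \<Sum>l=1..n. \<Sum>j=1..n. x i * y j * (v l i * v l j))"
    by (rule sum.swap)
  also have "\<dots> = (\<Sum>i=1..n. \<Sum>j=1..n. \<Sum>l=1..n. x i * y j * (v l i * v l j))"
    by (rule sum.cong[OF refl], rule sum.swap)
  also have "\<dots> = (\<Sum>i=1..n. \<Sum>j=1..n. x i * y j * (if i = j then 1 else 0))"
    by (intro sum.cong refl) (simp only: complete flip: sum_distrib_left)
  also have "\<dots> = (\<Sum>i=1..n. x i * y i)"
    by (rule sum.cong) (simp_all add: if_distrib cong: if_cong)
  finally show ?thesis by (simp add: dotp_def)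
qed

lemma parseval_self: "dotp n x x = (\<Sum>l=1..n. (dotp n (v l) x)\<^sup>2)"
  using parseval[of x x] by (simp add: power2_eq_square)

end

text \<open>Two homogeneous equations in three unknowns have a nontrivial solution. It will give, in
  the span of three eigenvectors, a nonzero vector orthogonal to both \<open>e\<close> and
  \<open>u\<close>, on which the rank-two part vanishes.\<close>

lemma common_orthogonal_vector3:
  fixes a1 a2 a3 b1 b2 b3 :: real
  obtains c1 c2 c3 :: real where "c1 * a1 + c2 * a2 + c3 * a3 = 0" "c1 * b1 + c2 * b2 + c3 * b3 = 0"
    "c1\<^sup>2 + c2\<^sup>2 + c3\<^sup>2 > 0"
proof -
  define S :: "(real^3) set" where "S = {vector [a1,a2,a3], vector [b1,b2,b3]}"
  have "dim S \<le> card S" by (rule dim_le_card') (simp add: S_def)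
  also have "\<dots> \<le> 2" by (simp add: S_def card_insert_if)
  also have "2 < DIM(real^3)" by simp
  finally have "dim S < DIM(real^3)" .
  then obtain x :: "real^3" where x: "x \<noteq> 0" "\<And>y. y \<in> span S \<Longrightarrow> orthogonal x y"
    using orthogonal_to_subspace_exists by blast
  have "orthogonal x (vector [a1,a2,a3])" "orthogonal x (vector [b1,b2,b3])"
    by (rule x(2), rule span_base, simp add: S_def)+
  then have *: "x$1 * a1 + x$2 * a2 + x$3 * a3 = 0" "x$1 * b1 + x$2 * b2 + x$3 * b3 = 0"
    by (simp_all add: orthogonal_def inner_vec_def sum_3)
  have "inner x x > 0" using x(1) by simp
  then have "(x$1)\<^sup>2 + (x$2)\<^sup>2 + (x$3)\<^sup>2 > 0"
    by (simp add: inner_vec_def sum_3 power2_eq_square)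
  with * show thesis using that by blast
qed

text \<open>A version of the Davis-Kahan theorem for the second eigenvalue of a perturbation T of
  a ee' + b uu'.\<close>
locale rank2_perturbation = orthonormal_basis n v
  for n :: nat and v :: "nat \<Rightarrow> nat \<Rightarrow> real" +
  fixes A T :: "nat \<Rightarrow> nat \<Rightarrow> real" and ev e u :: "nat \<Rightarrow> real" and a b \<tau> :: real
  assumes n2: "n \<ge> 2"
    and sym: "\<And>i j. A i j = A j i"
    and eig: "l \<in> {1..n} \<Longrightarrow> is_eigvec n A (ev l) (v l)"
    and ev_sorted: "l \<in> {1..n} \<Longrightarrow> l' \<in> {1..n} \<Longrightarrow> l \<le> l' \<Longrightarrow> \<bar>ev l'\<bar> \<le> \<bar>ev l\<bar>"
    and A_eq: "i \<in> {1..n} \<Longrightarrow> j \<in> {1..n} \<Longrightarrow> A i j = a * (e i * e j) + b * (u i * u j) + T i j"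
    and ee: "dotp n e e = 1" and uu: "dotp n u u = 1" and eu: "dotp n e u = 0"
    and T_le: "\<And>x. \<bar>dotp n x (mulv n T x)\<bar> \<le> \<tau> * dotp n x x"
    and a0: "a \<ge> 0" and b0: "b \<ge> 0"
begin

lemma mulv_A: "i \<in> {1..n} \<Longrightarrow> mulv n A x i = a * (dotp n e x * e i) + b * (dotp n u x * u i) + mulv n T x i"
proof -
  assume i: "i \<in> {1..n}"
  have "mulv n A x i = (\<Sum>j=1..n. a * e i * (e j * x j) + b * u i * (u j * x j) + T i j * x j)"
    unfolding mulv_def by (rule sum.cong) (use i in \<open>simp_all add: A_eq algebra_simps\<close>)
  also have "\<dots> = a * (dotp n e x * e i) + b * (dotp n u x * u i) + mulv n T x i"
    by (simp add: sum.distrib dotp_def mulv_def flip: sum_distrib_left)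
  finally show ?thesis .
qed

lemma form_A: "dotp n x (mulv n A x) = a * (dotp n e x)\<^sup>2 + b * (dotp n u x)\<^sup>2 + dotp n x (mulv n T x)"
proof -
  have "dotp n x (mulv n A x)
      = dotp n x (\<lambda>i. a * (dotp n e x * e i) + b * (dotp n u x * u i) + mulv n T x i)"
    by (rule dotp_cong) (simp_all add: mulv_A)
  also have "\<dots> = a * (dotp n e x)\<^sup>2 + b * (dotp n u x)\<^sup>2 + dotp n x (mulv n T x)"
    by (simp add: dotp_simps power2_eq_square dotp_commute[of n x])
  finally show ?thesis .
qed

lemma mulv_v: "l \<in> {1..n} \<Longrightarrow> i \<in> {1..n} \<Longrightarrow> mulv n A (v l) i = ev l * v l i"
  using eig[of l] by (simp add: is_eigvec_def mulv_def)

lemma v_mulv: "l \<in> {1..n} \<Longrightarrow> dotp n (v l) (mulv n A x) = ev l * dotp n (v l) x"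
proof -
  assume l: "l \<in> {1..n}"
  have "dotp n (v l) (mulv n A x) = dotp n (mulv n A (v l)) x"
    by (rule dotp_mulv_sym) (rule sym)
  also have "\<dots> = dotp n (\<lambda>i. ev l * v l i) x"
    by (rule dotp_cong) (use l in \<open>simp_all add: mulv_v del: atLeastAtMost_iff\<close>)
  finally show ?thesis by (simp add: dotp_scale_left)
qed

lemma form_A_ev: "dotp n x (mulv n A x) = (\<Sum>l=1..n. ev l * (dotp n (v l) x)\<^sup>2)"
  by (subst parseval) (simp add: v_mulv power2_eq_square mult_ac)

text \<open>The rank-two part is positive semidefinite, so only \<open>T\<close> can push an
  eigenvalue below zero. This turns information on \<open>\<bar>ev l\<bar>\<close>, the quantity
  that is sorted, into information on \<open>ev l\<close> itself.\<close>

lemma ev_lower: "l \<in> {1..n} \<Longrightarrow> - \<tau> \<le> ev l"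
proof -
  assume l: "l \<in> {1..n}"
  have "ev l = dotp n (v l) (mulv n A (v l))" using l by (simp add: v_mulv orth)
  moreover have "0 \<le> a * (dotp n e (v l))\<^sup>2 + b * (dotp n u (v l))\<^sup>2" using a0 b0 by simp
  ultimately show ?thesis using form_A[of "v l"] T_le[of "v l"] l by (simp add: orth)
qed

lemma ev1_lower: "a - \<tau> \<le> \<bar>ev 1\<bar>"
proof -
  have "a - \<tau> \<le> dotp n e (mulv n A e)"
    using form_A[of e] T_le[of e] by (simp add: ee dotp_commute[of n u e] eu)
  also have "\<dots> \<le> (\<Sum>l=1..n. \<bar>ev 1\<bar> * (dotp n (v l) e)\<^sup>2)"
    unfolding form_A_ev
  proof (intro sum_mono mult_right_mono)
    fix l assume "l \<in> {1..n}"
    then show "ev l \<le> \<bar>ev 1\<bar>" using ev_sorted[of 1 l] n2 by simp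
  qed auto
  also have "\<dots> = \<bar>ev 1\<bar> * dotp n e e" by (simp add: parseval_self flip: sum_distrib_left)
  finally show ?thesis by (simp add: ee)
qed

text \<open>A Courant-Fischer argument. Otherwise, by the ordering and \<open>ev_lower\<close>, the
  eigenvalues 1, 2 and l all exceed \<open>\<tau>\<close>, so the form of \<open>A\<close> exceeds
  \<open>\<tau>\<close> on the unit sphere of the span of their eigenvectors. That span meets the
  orthogonal complement of \<open>e\<close> and \<open>u\<close>, where the form of \<open>A\<close>
  is that of \<open>T\<close>.\<close>

lemma ev3_upper:
  assumes l: "l \<in> {1..n}" "l \<ge> 3"
  shows "\<bar>ev l\<bar> \<le> \<tau>"
proof (rule ccontr)
  assume "\<not> ?thesis"
  then have big: "\<tau> < \<bar>ev l\<bar>" by simp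
  have in_n: "1 \<in> {1..n}" "2 \<in> {1..n}" using n2 by auto
  have "\<tau> < \<bar>ev 1\<bar>" "\<tau> < \<bar>ev 2\<bar>" using big ev_sorted[of 1 l] ev_sorted[of 2 l] l in_n by auto
  then have gt: "\<tau> < ev 1" "\<tau> < ev 2" "\<tau> < ev l"
    using big ev_lower in_n l(1) by (smt (verit))+
  obtain c1 c2 c3 where c:
    "c1 * dotp n e (v 1) + c2 * dotp n e (v 2) + c3 * dotp n e (v l) = 0"
    "c1 * dotp n u (v 1) + c2 * dotp n u (v 2) + c3 * dotp n u (v l) = 0"
    "c1\<^sup>2 + c2\<^sup>2 + c3\<^sup>2 > 0"
    by (rule common_orthogonal_vector3)
  define x where "x = (\<lambda>i. c1 * v 1 i + c2 * v 2 i + c3 * v l i)"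
  have ex: "dotp n e x = 0" "dotp n u x = 0"
    using c(1,2) by (simp_all add: x_def dotp_simps)
  have vx: "dotp n (v k) x = (if k = 1 then c1 else 0) + (if k = 2 then c2 else 0) + (if k = l then c3 else 0)"
    if "k \<in> {1..n}" for k
    using that in_n l by (auto simp: x_def dotp_simps orth)
  have sq: "(dotp n (v k) x)\<^sup>2 = (if k = 1 then c1\<^sup>2 else 0) + (if k = 2 then c2\<^sup>2 else 0) + (if k = l then c3\<^sup>2 else 0)"
    if "k \<in> {1..n}" for k
    using that l by (auto simp: vx)
  have pick: "(\<Sum>k=1..n. f k * (dotp n (v k) x)\<^sup>2) = f 1 * c1\<^sup>2 + f 2 * c2\<^sup>2 + f l * c3\<^sup>2" for f
  proof -
    have "(\<Sum>k=1..n. f k * (dotp n (v k) x)\<^sup>2)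
       = (\<Sum>k=1..n. (if k = 1 then f 1 * c1\<^sup>2 else 0) + (if k = 2 then f 2 * c2\<^sup>2 else 0) + (if k = l then f l * c3\<^sup>2 else 0))"
      by (rule sum.cong) (auto simp: sq algebra_simps)
    also have "\<dots> = f 1 * c1\<^sup>2 + f 2 * c2\<^sup>2 + f l * c3\<^sup>2"
      using in_n l by (simp add: sum.distrib)
    finally show ?thesis .
  qed
  have "dotp n x x = c1\<^sup>2 + c2\<^sup>2 + c3\<^sup>2"
    using pick[of "\<lambda>_. 1"] by (simp add: parseval_self)
  moreover have "dotp n x (mulv n A x) = ev 1 * c1\<^sup>2 + ev 2 * c2\<^sup>2 + ev l * c3\<^sup>2"
    unfolding form_A_ev by (rule pick)
  moreover have "dotp n x (mulv n A x) \<le> \<tau> * dotp n x x"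
    using form_A[of x] ex T_le[of x] by simp
  ultimately have "(ev 1 - \<tau>) * c1\<^sup>2 + (ev 2 - \<tau>) * c2\<^sup>2 + (ev l - \<tau>) * c3\<^sup>2 \<le> 0"
    by (simp add: algebra_simps)
  moreover have "(ev 1 - \<tau>) * c1\<^sup>2 \<ge> 0" "(ev 2 - \<tau>) * c2\<^sup>2 \<ge> 0" "(ev l - \<tau>) * c3\<^sup>2 \<ge> 0"
    using gt by auto
  ultimately have "(ev 1 - \<tau>) * c1\<^sup>2 = 0" "(ev 2 - \<tau>) * c2\<^sup>2 = 0" "(ev l - \<tau>) * c3\<^sup>2 = 0"
    by linarith+
  then show False using gt c(3) by auto
qed

text \<open>Since \<open>e\<close> is orthogonal to \<open>u\<close>, A u - b u = T u. In the
  eigenbasis the coefficient of T u at \<open>v l\<close> is \<open>ev l - b\<close> times that of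
  \<open>u\<close>, and every \<open>l\<close> other than 2 has \<open>ev l\<close> at distance at
  least \<open>g\<close> from \<open>b\<close>. So the part of \<open>u\<close> off
  \<open>v 2\<close> has squared norm at most \<open>\<epsilon> / g\<^sup>2\<close>.\<close>

lemma eigvec_close:
  assumes y: "is_eigvec n A (ev 2) y" "dotp n y y = 1" "dotp n y u \<ge> 0"
    and g: "g > 0" "\<tau> + g \<le> b" "b + g + \<tau> \<le> a"
    and Tu: "dotp n (mulv n T u) (mulv n T u) \<le> \<epsilon>"
  shows "dotp n (\<lambda>i. y i - u i) (\<lambda>i. y i - u i) \<le> 8 * \<epsilon> / g\<^sup>2"
proof -
  have in_n: "1 \<in> {1..n}" "2 \<in> {1..n}" using n2 by auto
  have yu: "dotp n (\<lambda>i. y i - u i) (\<lambda>i. y i - u i) = 2 - 2 * dotp n y u"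
    by (simp add: dotp_simps y uu dotp_commute[of n u y])
  show ?thesis
  \<comment> \<open>The sign condition alone gives squared distance at most 2, and 2 = 8 * (1/4):
    this is the origin of the factor 8. Below the threshold the true constant would be 2.\<close>
  proof (cases "\<epsilon> / g\<^sup>2 \<le> 1 / 4")
    case False
    have "dotp n (\<lambda>i. y i - u i) (\<lambda>i. y i - u i) \<le> 2" using yu y(3) by simp
    also have "\<dots> \<le> 8 * (\<epsilon> / g\<^sup>2)" using False by simp
    finally show ?thesis by simp
  next
    case True
    define c where "c = (\<lambda>l. dotp n (v l) u)"
    have T_nonneg: "0 \<le> \<tau>" using T_le[of u] uu by simp
    have gap: "g\<^sup>2 \<le> (ev l - b)\<^sup>2" if "l \<in> {1..n}" "l \<noteq> 2" for l
    proof -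
      have "g \<le> \<bar>ev l - b\<bar>"
      proof (cases "l = 1")
        case True
        have "ev 1 \<ge> b + g" using ev1_lower ev_lower[of 1] in_n g T_nonneg b0 by linarith
        then show ?thesis using True by simp
      next
        case False
        then have "l \<ge> 3" using that by auto
        then show ?thesis using ev3_upper[of l] that g by linarith
      qed
      then show ?thesis using g(1) by (metis abs_le_square_iff abs_of_pos)
    qed
    have res: "dotp n (v l) (mulv n T u) = (ev l - b) * c l" if "l \<in> {1..n}" for l
    proof -
      have "dotp n (v l) (mulv n A u) = dotp n (v l) (\<lambda>i. b * u i + mulv n T u i)"
        by (rule dotp_cong) (simp_all add: mulv_A eu uu)
      then show ?thesis using v_mulv[OF that, of u] by (simp add: dotp_simps c_def algebra_simps)
    qed
    have "(\<Sum>l=1..n. (ev l - b)\<^sup>2 * (c l)\<^sup>2) = dotp n (mulv n T u) (mulv n T u)"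
      unfolding parseval_self[of "mulv n T u"]
      by (rule sum.cong) (simp_all add: res power_mult_distrib)
    then have tot: "(\<Sum>l=1..n. (ev l - b)\<^sup>2 * (c l)\<^sup>2) \<le> \<epsilon>" using Tu by simp
    have split: "(\<Sum>l=1..n. f l) = f 2 + (\<Sum>l\<in>{1..n}-{2}. f l)" for f :: "nat \<Rightarrow> real"
      using in_n by (subst sum.remove[of _ 2]) auto
    have c_tot: "1 = (c 2)\<^sup>2 + (\<Sum>l\<in>{1..n}-{2}. (c l)\<^sup>2)"
      using parseval_self[of u] uu split[of "\<lambda>l. (c l)\<^sup>2"] by (simp add: c_def)
    have "g\<^sup>2 * (\<Sum>l\<in>{1..n}-{2}. (c l)\<^sup>2) \<le> (\<Sum>l\<in>{1..n}-{2}. (ev l - b)\<^sup>2 * (c l)\<^sup>2)"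
      unfolding sum_distrib_left by (intro sum_mono mult_right_mono gap) auto
    then have both: "(ev 2 - b)\<^sup>2 * (c 2)\<^sup>2 + g\<^sup>2 * (1 - (c 2)\<^sup>2) \<le> \<epsilon>"
    proof -
      have "1 - (c 2)\<^sup>2 = (\<Sum>l\<in>{1..n}-{2}. (c l)\<^sup>2)" using c_tot by linarith
      then have "g\<^sup>2 * (1 - (c 2)\<^sup>2) \<le> (\<Sum>l\<in>{1..n}-{2}. (ev l - b)\<^sup>2 * (c l)\<^sup>2)"
        using \<open>g\<^sup>2 * _ \<le> _\<close> by simp
      then show ?thesis
        using tot split[of "\<lambda>l. (ev l - b)\<^sup>2 * (c l)\<^sup>2"] by linarith
    qed
    have c2_le: "(c 2)\<^sup>2 \<le> 1" using c_tot sum_nonneg[of "{1..n}-{2}" "\<lambda>l. (c l)\<^sup>2"] by simp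
    have "g\<^sup>2 * (1 - (c 2)\<^sup>2) \<le> \<epsilon>" using both zero_le_mult_iff[of "(ev 2 - b)\<^sup>2" "(c 2)\<^sup>2"]
      by (smt (verit) zero_le_power2 mult_nonneg_nonneg)
    then have c2_ge: "1 - (c 2)\<^sup>2 \<le> \<epsilon> / g\<^sup>2" using g(1) by (simp add: field_simps)
    \<comment> \<open>At least 3/4 of the mass of \<open>u\<close> sits on \<open>v 2\<close>, so
      the single term l = 2 already forces (ev 2 - b)^2 below g^2. Hence \<open>ev 2\<close> differs
      from every other eigenvalue, and \<open>y\<close> must be \<open>v 2\<close> up to
      sign.\<close>
    have ev2: "(ev 2 - b)\<^sup>2 < g\<^sup>2"
    proof -
      have "(ev 2 - b)\<^sup>2 * (3/4) \<le> (ev 2 - b)\<^sup>2 * (c 2)\<^sup>2"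
        by (rule mult_left_mono) (use c2_ge True in linarith, simp)
      also have "\<dots> \<le> \<epsilon>"
      proof -
        have "0 \<le> g\<^sup>2 * (1 - (c 2)\<^sup>2)" using c2_le by simp
        then show ?thesis using both by linarith
      qed
      also have "\<epsilon> \<le> g\<^sup>2 / 4" using True g(1) by (simp add: field_simps)
      finally show ?thesis using zero_less_power[OF g(1), of 2] by linarith
    qed
    have vy: "dotp n (v l) y = 0" if l: "l \<in> {1..n}" "l \<noteq> 2" for l
    proof -
      have "dotp n (v l) (mulv n A y) = dotp n (v l) (\<lambda>i. ev 2 * y i)"
        by (rule dotp_cong) (use y(1) in \<open>simp_all add: is_eigvec_def mulv_def\<close>)
      then have "ev l * dotp n (v l) y = ev 2 * dotp n (v l) y"
        using v_mulv[OF l(1)] by (simp add: dotp_simps)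
      moreover have "ev l \<noteq> ev 2" using gap[OF l] ev2 by auto
      ultimately show ?thesis by simp
    qed
    have y2: "(dotp n (v 2) y)\<^sup>2 = 1"
      using parseval_self[of y] y(2) split[of "\<lambda>l. (dotp n (v l) y)\<^sup>2"] by (simp add: vy)
    have "dotp n y u = dotp n (v 2) y * c 2"
      using parseval[of y u] split[of "\<lambda>l. dotp n (v l) y * dotp n (v l) u"] by (simp add: vy c_def)
    then have "(dotp n y u)\<^sup>2 = (c 2)\<^sup>2" by (simp add: power_mult_distrib y2)
    moreover have "dotp n y u \<le> 1"
      using c2_le calculation by (metis abs_le_square_iff abs_of_nonneg one_power2 y(3) zero_le_one)
    \<comment> \<open>The sign convention for \<open>y\<close> places the inner product in [0,1],
      where the square is at most the number itself; this converts the bound on the mass into one on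
      2 - 2 <y,u>.\<close>
    then have "(dotp n y u)\<^sup>2 \<le> dotp n y u"
      using y(3) by (simp add: power2_eq_square mult_left_le)
    ultimately have "2 - 2 * dotp n y u \<le> 2 * (\<epsilon> / g\<^sup>2)" using c2_ge by linarith
    also have "\<dots> \<le> 8 * (\<epsilon> / g\<^sup>2)"
      using c2_ge c2_le by simp
    finally show ?thesis using yu by simp
  qed
qed

end

section \<open>Spectrum of the expected matrix\<close>

definition frob :: "nat \<Rightarrow> (nat \<Rightarrow> nat \<Rightarrow> real) \<Rightarrow> real" where
  "frob n A = (\<Sum>i=1..n. \<Sum>j=1..n. (A i j)\<^sup>2)"

lemma mulv_frob: "dotp n (mulv n A x) (mulv n A x) \<le> frob n A * dotp n x x"
proof -
  have "dotp n (mulv n A x) (mulv n A x) \<le> (\<Sum>i=1..n. (\<Sum>j=1..n. (A i j)\<^sup>2) * (\<Sum>j=1..n. (x j)\<^sup>2))"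
    unfolding dotp_self mulv_def by (intro sum_mono Cauchy_Schwarz_ineq_sum)
  then show ?thesis by (simp add: frob_def dotp_self sum_distrib_right)
qed

lemma form_frob:
  assumes "frob n A \<le> c\<^sup>2" "0 \<le> c"
  shows "\<bar>dotp n x (mulv n A x)\<bar> \<le> c * dotp n x x"
proof -
  have "(dotp n x (mulv n A x))\<^sup>2 \<le> dotp n x x * dotp n (mulv n A x) (mulv n A x)"
    by (rule dotp_Cauchy_Schwarz)
  also have "\<dots> \<le> dotp n x x * (c\<^sup>2 * dotp n x x)"
    by (intro mult_left_mono order.trans[OF mulv_frob] mult_right_mono assms) auto
  also have "\<dots> = (c * dotp n x x)\<^sup>2" by (simp add: power2_eq_square)
  finally show ?thesis
    using assms(2) abs_le_square_iff[of "dotp n x (mulv n A x)" "c * dotp n x x"] by simp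
qed

lemma sum_rank1: "(\<Sum>i=1..n. \<Sum>j=1..n. (x i * y j) * (z i * w j)) = dotp n x z * dotp n y w"
  unfolding dotp_def sum_product by (intro sum.cong refl) (simp only: mult_ac)

text \<open>Pythagoras: e e' and u u' are orthonormal for the Frobenius inner product, and
  \<open>a\<close>, \<open>m\<close> are the coefficients of \<open>B\<close> along them. Rayleigh
  quotients are used instead of eigenvalue equations because the constant vector will not be an
  eigenvector of the band matrix.\<close>

lemma frob_deflate:
  assumes ee: "dotp n e e = 1" and uu: "dotp n u u = 1" and eu: "dotp n e u = 0"
    and eBe: "dotp n e (mulv n B e) = a" and uBu: "dotp n u (mulv n B u) = m"
  shows "frob n (\<lambda>i j. B i j - a * (e i * e j) - m * (u i * u j)) = frob n B - a\<^sup>2 - m\<^sup>2"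
proof -
  have form: "dotp n x (mulv n B x) = (\<Sum>i=1..n. \<Sum>j=1..n. B i j * (x i * x j))" for x
    by (simp add: dotp_def mulv_def sum_distrib_left mult_ac)
  have "frob n (\<lambda>i j. B i j - a * (e i * e j) - m * (u i * u j))
      = (\<Sum>i=1..n. \<Sum>j=1..n. (B i j)\<^sup>2 + a\<^sup>2 * ((e i * e j) * (e i * e j)) + m\<^sup>2 * ((u i * u j) * (u i * u j))
          - 2 * a * (B i j * (e i * e j)) - 2 * m * (B i j * (u i * u j))
          + 2 * a * m * ((e i * e j) * (u i * u j)))"
    unfolding frob_def by (intro sum.cong refl) (simp add: power2_eq_square algebra_simps)
  also have "\<dots> = frob n B + a\<^sup>2 * (dotp n e e * dotp n e e) + m\<^sup>2 * (dotp n u u * dotp n u u)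
     - 2 * a * dotp n e (mulv n B e) - 2 * m * dotp n u (mulv n B u) + 2 * a * m * (dotp n e u * dotp n e u)"
    unfolding frob_def form sum_rank1[symmetric]
    by (simp only: sum.distrib sum_subtractf sum_distrib_left)
  also have "\<dots> = frob n B - a\<^sup>2 - m\<^sup>2"
    by (simp add: assms power2_eq_square)
  finally show ?thesis .
qed

section \<open>The band matrix of ones and its cosine eigenvector\<close>

definition band :: "nat \<Rightarrow> nat \<Rightarrow> nat \<Rightarrow> real" where
  "band s i j = (if \<bar>int i - int j\<bar> \<le> int s - 1 then 1 else 0)"

text \<open>Filling the diagonal makes each row a full interval of ones; the price is a multiple of
  the identity, which only shifts the spectrum.\<close>

lemma bandM_band: "s \<ge> 1 \<Longrightarrow> bandM s p i j = p * (band s i j - (if i = j then 1 else 0))"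
  by (auto simp: bandM_def band_def)

text \<open>A row of the upper half is the indicator of a prefix, a row of the lower half that of
  the complement of a prefix. The eigenvalue equation is thereby reduced to prefix sums of
  \<open>u_vec\<close>.\<close>

lemma band_row_low:
  assumes "i \<in> {1..s}"
  shows "(\<Sum>j=1..2 * s. band s i j * x j) = (\<Sum>j=1..i+s-1. x j)"
proof -
  have "(\<Sum>j=1..2 * s. band s i j * x j) = (\<Sum>j=1..2 * s. if j \<in> {1..i+s-1} then x j else 0)"
    by (rule sum.cong) (use assms in \<open>auto simp: band_def\<close>)
  also have "\<dots> = (\<Sum>j\<in>{1..2 * s} \<inter> {1..i+s-1}. x j)"
    by (simp only: sum.inter_restrict[symmetric] finite_atLeastAtMost)
  also have "{1..2 * s} \<inter> {1..i+s-1} = {1..i+s-1}" using assms by auto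
  finally show ?thesis .
qed

lemma band_row_high:
  assumes "i \<in> {s+1..2 * s}"
  shows "(\<Sum>j=1..2 * s. band s i j * x j) = (\<Sum>j=1..2 * s. x j) - (\<Sum>j=1..i-s. x j)"
proof -
  have "(\<Sum>j=1..2 * s. band s i j * x j) = (\<Sum>j=1..2 * s. x j - (if j \<in> {1..i-s} then x j else 0))"
    by (rule sum.cong) (use assms in \<open>auto simp: band_def\<close>)
  also have "\<dots> = (\<Sum>j=1..2 * s. x j) - (\<Sum>j\<in>{1..2 * s} \<inter> {1..i-s}. x j)"
    by (simp only: sum_subtractf sum.inter_restrict[symmetric] finite_atLeastAtMost)
  also have "{1..2 * s} \<inter> {1..i-s} = {1..i-s}" using assms by auto
  finally show ?thesis .
qed

lemma band_total: "(\<Sum>i=1..2 * s. \<Sum>j=1..2 * s. band s i j) = real s * (3 * real s - 1)"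
proof -
  have low: "(\<Sum>j=1..2 * s. band s i j) = real i + real s - 1" if "i \<in> {1..s}" for i
    using band_row_low[OF that, of "\<lambda>_. 1"] that by (simp add: of_nat_diff)
  have high: "(\<Sum>j=1..2 * s. band s (i + s) j) = 2 * real s - real i" if "i \<in> {1..s}" for i
    using band_row_high[of "i + s" s "\<lambda>_. 1"] that by (simp add: of_nat_diff)
  have "(\<Sum>i=1..2 * s. \<Sum>j=1..2 * s. band s i j)
      = (\<Sum>i=1..s. \<Sum>j=1..2 * s. band s i j) + (\<Sum>i=s+1..2 * s. \<Sum>j=1..2 * s. band s i j)"
    using sum.ub_add_nat[of 1 s "\<lambda>i. \<Sum>j=1..2 * s. band s i j" s] by (simp add: mult_2)
  also have "(\<Sum>i=s+1..2 * s. \<Sum>j=1..2 * s. band s i j) = (\<Sum>i=1..s. \<Sum>j=1..2 * s. band s (i + s) j)"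
    using sum.shift_bounds_cl_nat_ivl[of "\<lambda>i. \<Sum>j=1..2 * s. band s i j" 1 s s] by (simp add: mult_2 add.commute)
  \<comment> \<open>Row i has i + s - 1 ones and row i + s has 2 s - i, so paired rows have a
    constant total.\<close>
  also have "(\<Sum>i=1..s. \<Sum>j=1..2 * s. band s i j) + \<dots> = (\<Sum>i=1..s. 3 * real s - 1)"
  proof (subst sum.distrib[symmetric], rule sum.cong[OF refl])
    fix i assume "i \<in> {1..s}"
    from low[OF this] high[OF this]
    show "(\<Sum>j=1..2 * s. band s i j) + (\<Sum>j=1..2 * s. band s (i + s) j) = 3 * real s - 1" by linarith
  qed
  finally show ?thesis by simp
qed

definition phi :: "nat \<Rightarrow> real" where "phi s = pi / (4 * real s + 2)"

lemma phi_pos: "0 < phi s" and phi_less_pi: "phi s < pi" and phi_mult: "(4 * real s + 2) * phi s = pi"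
  by (simp_all add: phi_def field_simps add_pos_nonneg)

lemma u_vec_low: "j \<le> s \<Longrightarrow> u_vec s j = cos ((2 * real j - 1) * phi s)"
  by (simp add: u_vec_def phi_def)

text \<open>Together with \<open>u_vec_low\<close> this shows \<open>u_vec\<close> to be the cosine
  sampled at odd multiples of \<open>phi s\<close>, with the sample at (2 s + 1) phi = pi / 2 left
  out. That sample is 0, so prefix sums telescope across the middle as if it were present.\<close>

lemma u_vec_high:
  assumes "s < j" "j \<le> 2 * s"
  shows "u_vec s j = cos ((2 * real j + 1) * phi s)"
proof -
  have "u_vec s j = - cos ((4 * real s - 2 * real j + 1) * phi s)"
  proof -
    have "2 * real (2 * s - j + 1) - 1 = 4 * real s - 2 * real j + 1"
      using assms by (simp add: of_nat_diff)
    moreover have "\<not> j \<le> s" using assms by simp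
    ultimately show ?thesis by (simp only: u_vec_def phi_def times_divide_eq_right if_False)
  qed
  also have "(4 * real s - 2 * real j + 1) * phi s = pi - (2 * real j + 1) * phi s"
    using phi_mult[of s] by (simp add: algebra_simps)
  finally show ?thesis by simp
qed

lemma sin_step: "2 * sin t * cos (x + t) = sin (x + 2 * t) - sin (x :: real)"
proof -
  have "x + 2 * t = (x + t) + t" "x = (x + t) - t" by simp_all
  then have "sin (x + 2 * t) - sin x = sin ((x + t) + t) - sin ((x + t) - t)" by metis
  also have "\<dots> = 2 * sin t * cos (x + t)" by (simp only: sin_add sin_diff) simp
  finally show ?thesis by simp
qed

lemma u_prefix_low: "m \<le> s \<Longrightarrow> 2 * sin (phi s) * (\<Sum>j=1..m. u_vec s j) = sin (2 * real m * phi s)"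
proof (induction m)
  case (Suc m)
  have "2 * sin (phi s) * u_vec s (Suc m) = sin (2 * real m * phi s + 2 * phi s) - sin (2 * real m * phi s)"
    using Suc.prems sin_step[of "phi s" "2 * real m * phi s"] by (simp add: u_vec_low algebra_simps)
  with Suc show ?case by (simp add: algebra_simps)
qed simp

lemma u_prefix_high:
  "s \<le> m \<Longrightarrow> m \<le> 2 * s \<Longrightarrow> 2 * sin (phi s) * (\<Sum>j=1..m. u_vec s j) = sin (2 * real m * phi s + 2 * phi s)"
proof (induction m rule: dec_induct)
  case base
  \<comment> \<open>At m = s the two prefix formulas agree: the angles 2 s phi and (2 s + 2) phi add
    up to pi.\<close>
  have "sin (2 * real s * phi s + 2 * phi s) = sin (pi - 2 * real s * phi s)"
    using phi_mult[of s] by (intro arg_cong[of _ _ sin]) (simp add: algebra_simps)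
  then show ?case using u_prefix_low[of s s] by simp
next
  case (step m)
  have "2 * sin (phi s) * u_vec s (Suc m)
      = sin (2 * real m * phi s + 2 * phi s + 2 * phi s) - sin (2 * real m * phi s + 2 * phi s)"
    using step sin_step[of "phi s" "2 * real m * phi s + 2 * phi s"]
    by (simp add: u_vec_high algebra_simps)
  with step show ?case by (simp add: algebra_simps)
qed

lemma sin_phi_pos: "0 < sin (phi s)"
  using phi_pos phi_less_pi by (rule sin_gt_zero)

lemma u_total: "(\<Sum>j=1..2 * s. u_vec s j) = 0"
proof -
  have "2 * sin (phi s) * (\<Sum>j=1..2 * s. u_vec s j) = sin ((4 * real s + 2) * phi s)"
    using u_prefix_high[of s "2 * s"] by (simp add: algebra_simps)
  then show ?thesis using sin_phi_pos[of s] by (simp add: phi_mult)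
qed

definition mu :: "nat \<Rightarrow> real" where "mu s = 1 / (2 * sin (phi s))"

text \<open>The prefix sum selected by row i is a sine at an angle that differs by pi / 2 from the
  angle of \<open>u_vec s i\<close>, because 2 s + 1 steps of \<open>phi s\<close> make a quarter
  period. The sine thus becomes the cosine again.\<close>

lemma band_u:
  assumes "i \<in> {1..2 * s}"
  shows "mulv (2 * s) (band s) (u_vec s) i = mu s * u_vec s i"
proof -
  have "2 * sin (phi s) * mulv (2 * s) (band s) (u_vec s) i = u_vec s i"
  proof (cases "i \<le> s")
    case True
    have "2 * sin (phi s) * mulv (2 * s) (band s) (u_vec s) i
        = 2 * sin (phi s) * (\<Sum>j=1..i+s-1. u_vec s j)"
      unfolding mulv_def by (subst band_row_low) (use True assms in auto)
    also have "\<dots> = sin (2 * real (i + s - 1) * phi s + 2 * phi s)"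
      by (rule u_prefix_high) (use True assms in auto)
    also have "2 * real (i + s - 1) * phi s + 2 * phi s = (2 * real i - 1) * phi s + pi / 2"
      using assms phi_mult[of s] by (simp add: of_nat_diff algebra_simps)
    finally show ?thesis using True by (simp add: u_vec_low sin_add)
  next
    case False
    have "2 * sin (phi s) * mulv (2 * s) (band s) (u_vec s) i
        = - (2 * sin (phi s) * (\<Sum>j=1..i-s. u_vec s j))"
      unfolding mulv_def by (subst band_row_high) (use False assms in \<open>auto simp: u_total[simplified]\<close>)
    also have "\<dots> = - sin (2 * real (i - s) * phi s)"
      by (subst u_prefix_low) (use False assms in auto)
    also have "\<dots> = cos (2 * real (i - s) * phi s + pi / 2)"
      by (simp add: cos_add)
    also have "2 * real (i - s) * phi s + pi / 2 = (2 * real i + 1) * phi s"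
      using False phi_mult[of s] by (simp add: of_nat_diff algebra_simps)
    finally show ?thesis using False assms by (simp add: u_vec_high)
  qed
  then show ?thesis using sin_phi_pos[of s] by (simp add: mu_def field_simps)
qed

text \<open>From sin x \<le> x one gets mu \<ge> 2 s / pi; 0.634 is 2 / pi rounded down.\<close>

lemma mu_lower: "(634/1000) * real s \<le> mu s"
proof -
  have "(634/1000) * real s * (2 * phi s) = (634/1000) * pi * (2 * real s / (4 * real s + 2))"
    by (simp add: phi_def)
  also have "\<dots> \<le> (634/1000) * pi * (1 / 2)"
    by (intro mult_left_mono) (simp_all add: field_simps)
  also have "\<dots> \<le> 1" using pi_approx by simp
  finally have "(634/1000) * real s * (2 * phi s) \<le> 1" .
  moreover have "(634/1000) * real s * (2 * sin (phi s)) \<le> (634/1000) * real s * (2 * phi s)"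
    using sin_x_le_x[of "phi s"] phi_pos[of s] by (intro mult_left_mono) auto
  ultimately have "(634/1000) * real s * (2 * sin (phi s)) \<le> 1" by linarith
  then show ?thesis using sin_phi_pos[of s] by (simp add: mu_def field_simps)
qed

section \<open>Removing the constant vector and the eigenvector from the band matrix\<close>

definition u_unit :: "nat \<Rightarrow> nat \<Rightarrow> real" where
  "u_unit s i = u_vec s i / sqrt (dotp (2 * s) (u_vec s) (u_vec s))"

lemma u_norm_pos:
  assumes "s \<ge> 1" shows "0 < dotp (2 * s) (u_vec s) (u_vec s)"
proof -
  have "6 * phi s \<le> (4 * real s + 2) * phi s"
    by (rule mult_right_mono) (use assms phi_pos[of s] in auto)
  then have "phi s < pi / 2" using phi_mult[of s] phi_pos[of s] by linarith
  then have "u_vec s 1 > 0" using assms phi_pos[of s] by (simp add: u_vec_low cos_gt_zero)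
  then have "0 < (u_vec s 1)\<^sup>2" by simp
  also have "\<dots> \<le> (\<Sum>i=1..2 * s. (u_vec s i)\<^sup>2)"
    by (rule member_le_sum) (use assms in auto)
  finally show ?thesis by (simp add: dotp_self)
qed

lemma u_norm_le: "dotp (2 * s) (u_vec s) (u_vec s) \<le> 2 * real s"
proof -
  have "(u_vec s i)\<^sup>2 \<le> 1" for i by (simp add: u_vec_def abs_square_le_1)
  then have "dotp (2 * s) (u_vec s) (u_vec s) \<le> (\<Sum>i=1..2 * s. 1)"
    unfolding dotp_self by (intro sum_mono) auto
  then show ?thesis by simp
qed

lemma u_unit_norm: "s \<ge> 1 \<Longrightarrow> dotp (2 * s) (u_unit s) (u_unit s) = 1"
  using u_norm_pos[of s] dotp_scale_left[of "2 * s" "1 / sqrt (dotp (2 * s) (u_vec s) (u_vec s))" "u_vec s" "u_unit s"]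
    dotp_scale_right[of "2 * s" "u_vec s" "1 / sqrt (dotp (2 * s) (u_vec s) (u_vec s))" "u_vec s"]
  by (simp add: u_unit_def[abs_def])

lemma mulv_scale: "mulv n A (\<lambda>i. c * x i) i = c * mulv n A x i"
  by (simp add: mulv_def sum_distrib_left mult_ac)

lemma band_u_unit: "i \<in> {1..2 * s} \<Longrightarrow> mulv (2 * s) (band s) (u_unit s) i = mu s * u_unit s i"
  using mulv_scale[of "2 * s" "band s" "1 / sqrt (dotp (2 * s) (u_vec s) (u_vec s))" "u_vec s" i] band_u[of i s]
  by (simp add: u_unit_def[abs_def])

definition e_unit :: "nat \<Rightarrow> nat \<Rightarrow> real" where
  "e_unit s i = 1 / sqrt (2 * real s)"

lemma e_unit_norm: "s \<ge> 1 \<Longrightarrow> dotp (2 * s) (e_unit s) (e_unit s) = 1"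
  by (simp add: dotp_def e_unit_def field_simps)

lemma e_u_orth: "dotp (2 * s) (e_unit s) (u_unit s) = 0"
proof -
  have "dotp (2 * s) (e_unit s) (u_unit s)
      = 1 / sqrt (2 * real s) * ((\<Sum>i=1..2 * s. u_vec s i) / sqrt (dotp (2 * s) (u_vec s) (u_vec s)))"
    by (simp add: dotp_def e_unit_def u_unit_def sum_divide_distrib sum_distrib_left)
  then show ?thesis by (simp only: u_total)
qed

definition remainder :: "nat \<Rightarrow> nat \<Rightarrow> nat \<Rightarrow> real" where
  "remainder s = (\<lambda>i j. band s i j - (3 * real s - 1) / 2 * (e_unit s i * e_unit s j)
     - mu s * (u_unit s i * u_unit s j))"

lemma frob_remainder:
  assumes s: "s \<ge> 1"
  shows "frob (2 * s) (remainder s) = (3 * (real s)\<^sup>2 + 2 * real s - 1) / 4 - (mu s)\<^sup>2"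
proof -
  have B2: "frob (2 * s) (band s) = real s * (3 * real s - 1)"
  proof -
    have "(band s i j)\<^sup>2 = band s i j" for i j by (simp add: band_def)
    then show ?thesis by (simp only: frob_def band_total)
  qed
  have "dotp (2 * s) (e_unit s) (mulv (2 * s) (band s) (e_unit s))
      = (\<Sum>i=1..2 * s. \<Sum>j=1..2 * s. 1 / (2 * real s) * band s i j)"
    by (simp add: dotp_def mulv_def e_unit_def sum_distrib_left sum_divide_distrib mult_ac)
  also have "\<dots> = 1 / (2 * real s) * (real s * (3 * real s - 1))"
    by (simp only: band_total flip: sum_distrib_left)
  finally have eBe: "dotp (2 * s) (e_unit s) (mulv (2 * s) (band s) (e_unit s)) = (3 * real s - 1) / 2"
    using s by simp
  have "dotp (2 * s) (u_unit s) (mulv (2 * s) (band s) (u_unit s)) = dotp (2 * s) (u_unit s) (\<lambda>i. mu s * u_unit s i)"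
    by (rule dotp_cong) (simp_all add: band_u_unit)
  then have uBu: "dotp (2 * s) (u_unit s) (mulv (2 * s) (band s) (u_unit s)) = mu s"
    using u_unit_norm[OF s] by (simp only: dotp_scale_right)
  have "frob (2 * s) (remainder s) = frob (2 * s) (band s) - ((3 * real s - 1) / 2)\<^sup>2 - (mu s)\<^sup>2"
    unfolding remainder_def
    by (rule frob_deflate[OF e_unit_norm[OF s] u_unit_norm[OF s] e_u_orth eBe uBu])
  also have "\<dots> = (3 * (real s)\<^sup>2 + 2 * real s - 1) / 4 - (mu s)\<^sup>2"
    unfolding B2 by (simp add: power2_eq_square field_simps)
  finally show ?thesis .
qed

text \<open>This exactness is what later leaves only noise in the perturbation applied to
  \<open>u_unit s\<close>.\<close>

lemma remainder_u_unit:
  assumes "s \<ge> 1" "i \<in> {1..2 * s}"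
  shows "mulv (2 * s) (remainder s) (u_unit s) i = 0"
proof -
  have "mulv (2 * s) (remainder s) (u_unit s) i = mulv (2 * s) (band s) (u_unit s) i
      - (3 * real s - 1) / 2 * e_unit s i * dotp (2 * s) (e_unit s) (u_unit s)
      - mu s * u_unit s i * dotp (2 * s) (u_unit s) (u_unit s)"
    unfolding mulv_def dotp_def sum_distrib_left sum_subtractf[symmetric]
    by (rule sum.cong) (simp_all add: remainder_def algebra_simps)
  then show ?thesis
    using band_u_unit[OF assms(2)] u_unit_norm[OF assms(1)] by (simp only: e_u_orth)
qed

text \<open>For \<open>s \<ge> 500\<close> the linear term costs at most 0.001 s^2 on top of 3/4
  s^2, and 0.751 - 0.634^2 < 0.591^2. The upper bound on \<open>mu s\<close> is obtained without
  estimating the sine from below: a squared Frobenius norm is nonnegative, so mu^2 \<le> 0.751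
  s^2.\<close>

lemma frob_remainder_le:
  assumes "s \<ge> 500"
  shows "frob (2 * s) (remainder s) \<le> ((591/1000) * real s)\<^sup>2" and "mu s \<le> (8667/10000) * real s"
proof -
  have s1: "s \<ge> 1" using assms by simp
  have "500 * real s \<le> (real s)\<^sup>2" using assms by (simp add: power2_eq_square)
  then have le: "(3 * (real s)\<^sup>2 + 2 * real s - 1) / 4 \<le> (751/1000) * (real s)\<^sup>2" by simp
  have "((634/1000) * real s)\<^sup>2 \<le> (mu s)\<^sup>2" by (rule power_mono[OF mu_lower]) simp
  then have "(401/1000) * (real s)\<^sup>2 \<le> (mu s)\<^sup>2 - (956/1000000) * (real s)\<^sup>2" by (simp add: power_mult_distrib power2_eq_square)
  moreover have "((591/1000) * real s)\<^sup>2 = (349281/1000000) * (real s)\<^sup>2" by (simp add: power_mult_distrib power2_eq_square)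
  ultimately show "frob (2 * s) (remainder s) \<le> ((591/1000) * real s)\<^sup>2"
    using le zero_le_power2[of "real s"] unfolding frob_remainder[OF s1] by linarith
  have "0 \<le> frob (2 * s) (remainder s)" by (simp add: frob_def sum_nonneg)
  then have "(mu s)\<^sup>2 \<le> (751/1000) * (real s)\<^sup>2"
    using le unfolding frob_remainder[OF s1] by linarith
  also have "\<dots> \<le> ((8667/10000) * real s)\<^sup>2" by (simp add: power_mult_distrib power2_eq_square)
  finally show "mu s \<le> (8667/10000) * real s" by (rule power2_le_imp_le) simp
qed

text \<open>The deterministic half of the argument. The operator bound on the noise only secures the
  spectral gap p s / 50; the quality of the approximation is governed by the separate bound
  \<open>\<epsilon>\<close> for the noise applied to \<open>u_unit s\<close>.\<close>

lemma second_eigvec_close: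
  fixes A :: "nat \<Rightarrow> nat \<Rightarrow> real" and p :: real
  defines "E \<equiv> (\<lambda>s i j. A i j - bandM s p i j)"
  assumes s: "s \<ge> 500" and p: "0 < p" and sym: "\<And>i j. A i j = A j i"
    and E_le: "\<And>x. \<bar>dotp (2 * s) x (mulv (2 * s) (E s) x)\<bar> \<le> p * real s / 100 * dotp (2 * s) x x"
    and Eu: "dotp (2 * s) (mulv (2 * s) (E s) (u_unit s)) (mulv (2 * s) (E s) (u_unit s)) \<le> \<epsilon>"
    and lam: "second_eigenvalue (2 * s) A lam" and y: "is_eigvec (2 * s) A lam y"
      "dotp (2 * s) y y = 1" "dotp (2 * s) y (u_vec s) \<ge> 0"
  shows "dotp (2 * s) (\<lambda>i. y i - u_unit s i) (\<lambda>i. y i - u_unit s i) \<le> 8 * \<epsilon> / (p * real s / 50)\<^sup>2"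
proof -
  define n where "n = 2 * s"
  define u where "u = u_unit s"
  define I :: "nat \<Rightarrow> nat \<Rightarrow> real" where "I = (\<lambda>i j. if i = j then 1 else 0)"
  \<comment> \<open>The empty diagonal contributes -p I. Moving p u u' from the main part into
    \<open>T\<close> lowers the coefficient of u u' to p (mu - 1) and makes the deterministic part
    of \<open>T\<close> annihilate \<open>u\<close>.\<close>
  define T where "T = (\<lambda>i j. p * (remainder s i j + u i * u j - I i j) + E s i j)"
  define a where "a = p * (3 * real s - 1) / 2"
  define b where "b = p * (mu s - 1)"
  define \<tau> where "\<tau> = p * ((591/1000) * real s + 1) + p * real s / 100"
  have s1: "s \<ge> 1" using s by simp
  have s2: "1 \<le> (2/1000) * real s" using s by simp
  obtain ev v where v: "\<And>l. l \<in> {1..n} \<Longrightarrow> is_eigvec n A (ev l) (v l)"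
    "\<And>l l'. l \<in> {1..n} \<Longrightarrow> l' \<in> {1..n} \<Longrightarrow> dotp n (v l) (v l') = (if l = l' then 1 else 0)"
    "\<And>l l'. l \<in> {1..n} \<Longrightarrow> l' \<in> {1..n} \<Longrightarrow> l \<le> l' \<Longrightarrow> \<bar>ev l'\<bar> \<le> \<bar>ev l\<bar>" "lam = ev 2"
    using lam unfolding second_eigenvalue_def n_def dotp_def by blast
  have mulT: "mulv n T x i = p * (mulv n (remainder s) x i + dotp n u x * u i - x i) + mulv n (E s) x i"
    if "i \<in> {1..n}" for x i
  proof -
    have "mulv n I x i = (\<Sum>j=1..n. if i = j then x j else 0)"
      unfolding mulv_def I_def by (rule sum.cong) auto
    then have "mulv n I x i = x i" using that by simp
    moreover have "mulv n T x i = p * (mulv n (remainder s) x i + dotp n u x * u i - mulv n I x i) + mulv n (E s) x i"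
      by (simp add: mulv_def T_def dotp_def algebra_simps sum.distrib sum_subtractf sum_distrib_left)
    ultimately show ?thesis by simp
  qed
  interpret rank2_perturbation n v A T ev "e_unit s" u a b \<tau>
  proof
    show "n \<ge> 2" using s by (simp add: n_def)
    show "A i j = A j i" for i j by (rule sym)
    show "dotp n (e_unit s) (e_unit s) = 1" "dotp n u u = 1" "dotp n (e_unit s) u = 0"
      using e_unit_norm[OF s1] u_unit_norm[OF s1] e_u_orth[of s] by (simp_all only: n_def u_def)
    show "a \<ge> 0" using p s1 by (simp add: a_def)
    show "b \<ge> 0" using p mu_lower[of s] s by (simp add: b_def)
    show "A i j = a * (e_unit s i * e_unit s j) + b * (u i * u j) + T i j" for i j
      by (simp add: T_def E_def a_def b_def bandM_band[OF s1] remainder_def I_def u_def algebra_simps add_divide_distrib diff_divide_distrib)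
    show "\<bar>dotp n x (mulv n T x)\<bar> \<le> \<tau> * dotp n x x" for x
    proof -
      have "dotp n x (mulv n T x)
          = dotp n x (\<lambda>i. p * (mulv n (remainder s) x i + dotp n u x * u i - x i) + mulv n (E s) x i)"
        by (rule dotp_cong) (simp_all add: mulT)
      also have "\<dots> = p * dotp n x (mulv n (remainder s) x) - p * (dotp n x x - (dotp n u x)\<^sup>2)
          + dotp n x (mulv n (E s) x)"
        by (simp only: dotp_simps dotp_commute[of n x u]) (simp add: power2_eq_square algebra_simps)
      finally have eq: "dotp n x (mulv n T x) = \<dots>" .
      have "\<bar>dotp n x (mulv n (remainder s) x)\<bar> \<le> (591/1000) * real s * dotp n x x"
        using form_frob[OF frob_remainder_le(1)[OF s], of x] by (simp add: n_def)
      then have 1: "\<bar>p * dotp n x (mulv n (remainder s) x)\<bar> \<le> p * ((591/1000) * real s * dotp n x x)"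
        using p by (simp add: abs_mult)
      have "(dotp n u x)\<^sup>2 \<le> dotp n x x"
        using dotp_Cauchy_Schwarz[of n u x] u_unit_norm[OF s1] by (simp add: n_def u_def)
      then have 2: "\<bar>p * (dotp n x x - (dotp n u x)\<^sup>2)\<bar> \<le> p * dotp n x x"
        using p by (simp add: abs_mult)
      have 3: "\<bar>dotp n x (mulv n (E s) x)\<bar> \<le> p * real s / 100 * dotp n x x"
        using E_le[of x] by (simp only: n_def)
      have "\<bar>dotp n x (mulv n T x)\<bar> \<le> p * ((591/1000) * real s * dotp n x x) + p * dotp n x x
          + p * real s / 100 * dotp n x x"
        unfolding eq using 1 2 3 by linarith
      also have "\<dots> = \<tau> * dotp n x x" by (simp add: \<tau>_def algebra_simps)
      finally show ?thesis .
    qed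
  qed (use v in auto)
  have Tu: "mulv n T u i = mulv n (E s) u i" if "i \<in> {1..n}" for i
    using mulT[OF that, of u] remainder_u_unit[OF s1, of i] u_unit_norm[OF s1] that
    by (simp add: n_def u_def)
  have "dotp n (mulv n T u) (mulv n T u) = dotp n (mulv n (E s) u) (mulv n (E s) u)"
    by (rule dotp_cong) (simp_all add: Tu)
  then have Tu': "dotp n (mulv n T u) (mulv n T u) \<le> \<epsilon>"
    using Eu by (simp only: n_def u_def)
  have "dotp n y u = dotp n y (u_vec s) / sqrt (dotp n (u_vec s) (u_vec s))"
    by (simp add: dotp_def u_def u_unit_def n_def sum_divide_distrib)
  then have yu: "dotp n y u \<ge> 0" using y(3) by (simp only: n_def) simp
  have "dotp n (\<lambda>i. y i - u i) (\<lambda>i. y i - u i) \<le> 8 * \<epsilon> / (p * real s / 50)\<^sup>2"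
  proof (rule eigvec_close)
    show "is_eigvec n A (ev 2) y" using y(1) v(4) by (simp add: n_def)
    show "dotp n y y = 1" using y(2) by (simp add: n_def)
    show "0 < p * real s / 50" using p s1 by simp
    \<comment> \<open>In units of p s the two gap conditions read 0.591 + 0.01 + 0.02 < 0.634 and
      0.8667 + 0.02 + 0.591 + 0.01 < 1.5; \<open>s2\<close> absorbs the additive constants.\<close>
    have "(591/1000) * real s + 1 + real s / 100 + real s / 50 \<le> mu s - 1"
      using mu_lower[of s] s2 by linarith
    from mult_left_mono[OF this, of p] show "\<tau> + p * real s / 50 \<le> b"
      using p by (simp add: \<tau>_def b_def algebra_simps)
    have "mu s - 1 + real s / 50 + ((591/1000) * real s + 1 + real s / 100) \<le> (3 * real s - 1) / 2"
      using frob_remainder_le(2)[OF s] s2 by (simp add: field_simps)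
    from mult_left_mono[OF this, of p] show "b + p * real s / 50 + \<tau> \<le> a"
      using p by (simp add: \<tau>_def b_def a_def algebra_simps)
  qed (fact yu Tu')+
  then show ?thesis by (simp only: n_def u_def)
qed

section \<open>Concentration for independent Bernoulli variables\<close>

text \<open>The hypothesis \<open>dep\<close> says that \<open>f j\<close> is a function of the
  coordinates in \<open>K j\<close> alone, so each \<open>f j\<close> factors through the
  restriction to its block, and restrictions to disjoint blocks are independent.\<close>

lemma indep_vars_Pi_pmf_blocks:
  fixes f :: "'j \<Rightarrow> ('t \<Rightarrow> bool) \<Rightarrow> real"
  assumes "finite I" and K: "\<And>j. j \<in> J \<Longrightarrow> K j \<subseteq> I" and disj: "disjoint_family_on K J"
    and dep: "\<And>j X Y. j \<in> J \<Longrightarrow> (\<And>t. t \<in> K j \<Longrightarrow> X t = Y t) \<Longrightarrow> f j X = f j Y"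
  shows "prob_space.indep_vars (measure_pmf (Pi_pmf I d q)) (\<lambda>_. borel) f J"
proof -
  have "prob_space.indep_vars (measure_pmf (Pi_pmf I d q)) (\<lambda>j. PiM (K j) (\<lambda>_. count_space UNIV)) (\<lambda>j X. restrict (\<lambda>i. X i) (K j)) J"
    by (rule prob_space.indep_vars_restrict[OF measure_pmf.prob_space_axioms indep_vars_Pi_pmf]) (use assms in auto)
  then have "prob_space.indep_vars (measure_pmf (Pi_pmf I d q)) (\<lambda>_. borel) (\<lambda>j X. f j (restrict (\<lambda>i. X i) (K j))) J"
  proof (rule prob_space.indep_vars_compose2[OF measure_pmf.prob_space_axioms])
    fix j assume j: "j \<in> J"
    then have "finite (K j)" using K \<open>finite I\<close> by (metis finite_subset)
    then have "PiM (K j) (\<lambda>_. count_space (UNIV :: bool set)) = count_space (PiE (K j) (\<lambda>_. UNIV))"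
      by (rule count_space_PiM_finite) simp
    then show "f j \<in> PiM (K j) (\<lambda>_. count_space UNIV) \<rightarrow>\<^sub>M borel" by simp
  qed
  moreover have "f j (restrict (\<lambda>i. X i) (K j)) = f j X" if "j \<in> J" for j X
    by (rule dep[OF that]) simp
  ultimately show ?thesis
    by (subst prob_space.indep_vars_cong[OF measure_pmf.prob_space_axioms, where J=J and Y="\<lambda>j X. f j (restrict (\<lambda>i. X i) (K j))" and N'="\<lambda>_. borel"]) auto
qed

text \<open>The value of the geometric series with first term 2 exp (1/8) and ratio exp (-3/8),
  which bounds the exponential moment of a squared sum in \<open>exp_square_moment\<close>.\<close>

definition sq_moment :: real where
  "sq_moment = 2 * exp (1 / 8) / (1 - exp (- 3 / 8))"

lemma sq_moment_pos: "0 < sq_moment"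
  by (simp add: sq_moment_def)

text \<open>Chosen so that sq_moment^c / exp (sq_tail c / 16) = exp (-c) in the Markov step of
  \<open>sum_squares_tail\<close>.\<close>

definition sq_tail :: real where "sq_tail = 16 * (1 + ln sq_moment)"

locale bernoulli_field =
  fixes I :: "'t set" and P :: "'t \<Rightarrow> real" 
  assumes fin: "finite I" and P01: "t \<in> I \<Longrightarrow> 0 \<le> P t" "t \<in> I \<Longrightarrow> P t \<le> 1"
begin

definition Q :: "('t \<Rightarrow> bool) pmf" where
  "Q = Pi_pmf I False (\<lambda>t. bernoulli_pmf (P t))"

definition dev :: "'t \<Rightarrow> ('t \<Rightarrow> bool) \<Rightarrow> real" where
  "dev t X = (if X t then 1 else 0) - P t"

lemma finite_set_Q: "finite (set_pmf Q)"
  unfolding Q_def set_Pi_pmf[OF fin] by (rule finite_PiE_dflt) (use fin in auto)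

lemma integrable_Q [simp]: "integrable (measure_pmf Q) (f :: _ \<Rightarrow> real)"
  by (rule integrable_measure_pmf_finite[OF finite_set_Q])

lemma dev_bound: "t \<in> I \<Longrightarrow> \<bar>dev t X\<bar> \<le> 1"
  using P01[of t] by (auto simp: dev_def)

lemma expectation_component:
  "t \<in> I \<Longrightarrow> measure_pmf.expectation Q (\<lambda>X. g (X t)) = P t * g True + (1 - P t) * (g False :: real)"
proof -
  assume t: "t \<in> I"
  have "measure_pmf.expectation Q (\<lambda>X. g (X t)) = measure_pmf.expectation (map_pmf (\<lambda>X. X t) Q) g"
    by simp
  also have "map_pmf (\<lambda>X. X t) Q = bernoulli_pmf (P t)"
    unfolding Q_def by (subst Pi_pmf_component) (use fin t in auto)
  finally show ?thesis using P01[OF t] by simp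
qed

lemma expectation_dev: "t \<in> I \<Longrightarrow> measure_pmf.expectation Q (dev t) = 0"
  using expectation_component[of t "\<lambda>b. (if b then 1 else 0) - P t"]
  by (simp add: dev_def[abs_def] algebra_simps)

lemma indep_blocks:
  fixes f :: "'j \<Rightarrow> ('t \<Rightarrow> bool) \<Rightarrow> real"
  assumes "\<And>j. j \<in> J \<Longrightarrow> K j \<subseteq> I" "disjoint_family_on K J"
    and "\<And>j X Y. j \<in> J \<Longrightarrow> (\<And>t. t \<in> K j \<Longrightarrow> X t = Y t) \<Longrightarrow> f j X = f j Y"
  shows "prob_space.indep_vars (measure_pmf Q) (\<lambda>_. borel) f J"
  unfolding Q_def by (rule indep_vars_Pi_pmf_blocks[OF fin assms]) auto

lemma indep_dev: "prob_space.indep_vars (measure_pmf Q) (\<lambda>_. borel) dev I"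
  by (rule indep_blocks[where K="\<lambda>t. {t}"]) (auto simp: disjoint_family_on_def dev_def)

lemma expectation_dev_mult:
  assumes "t \<in> I" "t' \<in> I" "t \<noteq> t'"
  shows "measure_pmf.expectation Q (\<lambda>X. dev t X * dev t' X) = 0"
proof -
  have "prob_space.indep_vars (measure_pmf Q) (\<lambda>_. borel) dev {t, t'}"
    by (rule prob_space.indep_vars_subset[OF measure_pmf.prob_space_axioms indep_dev]) (use assms in auto)
  then have "measure_pmf.expectation Q (\<lambda>X. \<Prod>r\<in>{t,t'}. dev r X) = (\<Prod>r\<in>{t,t'}. measure_pmf.expectation Q (dev r))"
    by (intro prob_space.indep_vars_lebesgue_integral[OF measure_pmf.prob_space_axioms]) auto
  then show ?thesis using assms by (simp add: expectation_dev)
qed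

lemma hoeffding_blocks:
  fixes f :: "'j \<Rightarrow> ('t \<Rightarrow> bool) \<Rightarrow> real"
  assumes J: "finite J" and K: "\<And>j. j \<in> J \<Longrightarrow> K j \<subseteq> I" "disjoint_family_on K J"
    and dep: "\<And>j X Y. j \<in> J \<Longrightarrow> (\<And>t. t \<in> K j \<Longrightarrow> X t = Y t) \<Longrightarrow> f j X = f j Y"
    and bound: "\<And>j X. j \<in> J \<Longrightarrow> \<bar>f j X\<bar> \<le> c j"
    and mean: "\<And>j. j \<in> J \<Longrightarrow> measure_pmf.expectation Q (f j) = 0"
    and c: "(\<Sum>j\<in>J. (c j)\<^sup>2) \<le> V" "0 < V" and x: "0 \<le> x"
  shows "measure_pmf.prob Q {X. x \<le> \<bar>\<Sum>j\<in>J. f j X\<bar>} \<le> 2 * exp (- x\<^sup>2 / (2 * V))"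
proof (cases "(\<Sum>j\<in>J. (c j)\<^sup>2) = 0")
  \<comment> \<open>Hoeffding's inequality requires a positive sum of squared ranges. If all ranges
    vanish, so does the sum of the \<open>f j\<close>, and at x = 0 the claimed bound is 2.\<close>
  case True
  then have "c j = 0" if "j \<in> J" for j using J that by (simp add: sum_nonneg_eq_0_iff)
  then have z: "f j X = 0" if "j \<in> J" for j X using bound[OF that, of X] that by simp
  show ?thesis
  proof (cases "x = 0")
    case False
    then show ?thesis using x by (simp add: z)
  next
    case True
    then show ?thesis by (simp add: order.trans[OF measure_pmf.prob_le_1])
  qed
next
  case False
  define W where "W = (\<Sum>j\<in>J. (c j)\<^sup>2)"
  have W: "0 < W" using False sum_nonneg[of J "\<lambda>j. (c j)\<^sup>2"] by (simp add: W_def)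
  interpret Hoeffding_ineq "measure_pmf Q" J f "\<lambda>j. - c j" c 0
  proof unfold_locales
    show "prob_space.indep_vars (measure_pmf Q) (\<lambda>_. borel) f J"
      by (rule indep_blocks[OF K dep])
  qed (use J bound mean in \<open>auto simp: abs_le_iff minus_le_iff\<close>)
  have 4: "(\<Sum>j\<in>J. (c j - - c j)\<^sup>2) = 4 * W"
    by (simp add: W_def sum_distrib_left power2_eq_square algebra_simps)
  have "measure_pmf.prob Q {X. x \<le> \<bar>\<Sum>j\<in>J. f j X\<bar>} \<le> 2 * exp (- 2 * x\<^sup>2 / (4 * W))"
    using Hoeffding_ineq_abs_ge[OF x] W unfolding 4 by simp
  also have "- 2 * x\<^sup>2 / (4 * W) = - (x\<^sup>2 / (2 * W))" using W by simp
  also have "\<dots> \<le> - (x\<^sup>2 / (2 * V))"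
    using W c(1) by (simp add: W_def[symmetric] frac_le)
  finally show ?thesis by simp
qed

text \<open>Splitting according to the integer part m of the absolute value of the sum, this is a
  convergent series of Gaussian tails \<open>2 * exp (- m\<^sup>2 / 2)\<close> weighted by \<open>exp ((m + 1)\<^sup>2 / 16)\<close>.\<close>
lemma exp_square_moment:
  assumes T: "T \<subseteq> I" and w: "(\<Sum>t\<in>T. (w t)\<^sup>2) \<le> 1"
  shows "measure_pmf.expectation Q (\<lambda>X. exp ((\<Sum>t\<in>T. w t * dev t X)\<^sup>2 / 16)) \<le> sq_moment"
proof -
  define S where "S = (\<lambda>X. \<Sum>t\<in>T. w t * dev t X)"
  have finT: "finite T" using T fin finite_subset by blast
  have tail: "measure_pmf.prob Q {X. x \<le> \<bar>S X\<bar>} \<le> 2 * exp (- x\<^sup>2 / 2)" if "0 \<le> x" for x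
  proof -
    have "measure_pmf.prob Q {X. x \<le> \<bar>\<Sum>t\<in>T. w t * dev t X\<bar>} \<le> 2 * exp (- x\<^sup>2 / (2 * 1))"
    proof (rule hoeffding_blocks[where K="\<lambda>t. {t}" and c="\<lambda>t. \<bar>w t\<bar>"])
      show "\<bar>w t * dev t X\<bar> \<le> \<bar>w t\<bar>" if "t \<in> T" for t X
        using dev_bound[of t X] T that by (auto simp: abs_mult intro!: mult_left_le)
      show "measure_pmf.expectation Q (\<lambda>X. w t * dev t X) = 0" if "t \<in> T" for t
        using expectation_dev[of t] T that by auto
    qed (use T w finT that in \<open>auto simp: disjoint_family_on_def dev_def\<close>)
    then show ?thesis by (simp add: S_def)
  qed
  \<comment> \<open>A crude deterministic bound on the absolute value of \<open>S\<close>, so that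
    the splitting by integer parts is a finite sum.\<close>
  define N where "N = nat \<lceil>\<Sum>t\<in>T. \<bar>w t\<bar>\<rceil>"
  have S_N: "\<bar>S X\<bar> \<le> real N" for X
  proof -
    have "\<bar>S X\<bar> \<le> (\<Sum>t\<in>T. \<bar>w t * dev t X\<bar>)" unfolding S_def by (rule sum_abs)
    also have "\<dots> \<le> (\<Sum>t\<in>T. \<bar>w t\<bar>)"
      using dev_bound T by (intro sum_mono) (auto simp: abs_mult intro!: mult_left_le)
    also have "\<dots> \<le> real N" by (simp add: N_def)
    finally show ?thesis .
  qed
  have pt: "exp ((S X)\<^sup>2 / 16) \<le> (\<Sum>m\<le>N. exp ((real m + 1)\<^sup>2 / 16) * indicator {X. real m \<le> \<bar>S X\<bar>} X)" for X
  proof -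
    define m where "m = nat \<lfloor>\<bar>S X\<bar>\<rfloor>"
    have m: "real m \<le> \<bar>S X\<bar>" "\<bar>S X\<bar> \<le> real m + 1" by (simp_all add: m_def)
    have "m \<le> N" using m(1) S_N[of X] by linarith
    have "(S X)\<^sup>2 \<le> (real m + 1)\<^sup>2" using m(2) abs_le_square_iff[of "S X" "real m + 1"] by simp
    then have "exp ((S X)\<^sup>2 / 16) \<le> exp ((real m + 1)\<^sup>2 / 16) * indicator {X. real m \<le> \<bar>S X\<bar>} X"
      using m(1) by simp
    also have "\<dots> \<le> (\<Sum>m\<le>N. exp ((real m + 1)\<^sup>2 / 16) * indicator {X. real m \<le> \<bar>S X\<bar>} X)"
      using \<open>m \<le> N\<close> by (intro member_le_sum[of m "{..N}" "\<lambda>m. exp ((real m + 1)\<^sup>2 / 16) * indicator {X. real m \<le> \<bar>S X\<bar>} X"]) auto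
    finally show ?thesis .
  qed
  define r :: real where "r = exp (- 3 / 8)"
  have r: "0 < r" "r < 1" by (simp_all add: r_def)
  have "measure_pmf.expectation Q (\<lambda>X. exp ((S X)\<^sup>2 / 16))
      \<le> measure_pmf.expectation Q (\<lambda>X. \<Sum>m\<le>N. exp ((real m + 1)\<^sup>2 / 16) * indicator {X. real m \<le> \<bar>S X\<bar>} X)"
    by (intro integral_mono pt) auto
  also have "\<dots> = (\<Sum>m\<le>N. exp ((real m + 1)\<^sup>2 / 16) * measure_pmf.prob Q {X. real m \<le> \<bar>S X\<bar>})"
    by (subst Bochner_Integration.integral_sum) auto
  also have "\<dots> \<le> (\<Sum>m\<le>N. 2 * exp (1 / 8) * r ^ m)"
  proof (rule sum_mono)
    fix m
    \<comment> \<open>With (m + 1)^2 \<le> 2 m^2 + 2 the exponent (m + 1)^2 / 16 - m^2 / 2 is at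
      most 1/8 - 3 m^2 / 8, and m \<le> m^2 makes this linear in m. This is why 16 was an admissible
      denominator.\<close>
    have "real m \<le> (real m)\<^sup>2" using le_square[of m] by (simp add: power2_eq_square flip: of_nat_mult)
    moreover have "(real m + 1)\<^sup>2 \<le> 2 * (real m)\<^sup>2 + 2"
      using zero_le_power2[of "real m - 1"] by (simp add: power2_eq_square algebra_simps)
    ultimately have le: "(real m + 1)\<^sup>2 / 16 - (real m)\<^sup>2 / 2 \<le> 1 / 8 - 3 / 8 * real m" by linarith
    have "exp ((real m + 1)\<^sup>2 / 16) * measure_pmf.prob Q {X. real m \<le> \<bar>S X\<bar>}
        \<le> exp ((real m + 1)\<^sup>2 / 16) * (2 * exp (- (real m)\<^sup>2 / 2))"
      by (intro mult_left_mono tail) auto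
    also have "\<dots> = 2 * exp ((real m + 1)\<^sup>2 / 16 - (real m)\<^sup>2 / 2)"
      using exp_add[of "(real m + 1)\<^sup>2 / 16" "- (real m)\<^sup>2 / 2"] by simp
    also have "\<dots> \<le> 2 * exp (1 / 8 - 3 / 8 * real m)" using le by simp
    also have "\<dots> = 2 * exp (1 / 8) * r ^ m"
      unfolding r_def exp_of_nat_mult[symmetric] by (simp add: exp_add[symmetric] algebra_simps)
    finally show "exp ((real m + 1)\<^sup>2 / 16) * measure_pmf.prob Q {X. real m \<le> \<bar>S X\<bar>} \<le> 2 * exp (1 / 8) * r ^ m" .
  qed
  also have "\<dots> = 2 * exp (1 / 8) * (\<Sum>m\<le>N. r ^ m)" by (simp add: sum_distrib_left)
  also have "\<dots> \<le> 2 * exp (1 / 8) * (1 / (1 - r))"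
    using sum_le_suminf[of "\<lambda>m. r ^ m" "{..N}"] r by (intro mult_left_mono) (auto simp: suminf_geometric)
  finally show ?thesis by (simp add: S_def sq_moment_def r_def)
qed

text \<open>A squared block sum may be as large as its block, so Hoeffding applied to the squares
  would be too weak. Instead the exponential moments multiply over the independent blocks and
  Markov's inequality is applied to the product.\<close>

lemma sum_squares_tail:
  assumes J: "finite J" and K: "\<And>j. j \<in> J \<Longrightarrow> K j \<subseteq> I" "disjoint_family_on K J"
    and w: "\<And>j. j \<in> J \<Longrightarrow> (\<Sum>t\<in>K j. (w j t)\<^sup>2) \<le> 1"
  shows "measure_pmf.prob Q {X. sq_tail * real (card J) \<le> (\<Sum>j\<in>J. (\<Sum>t\<in>K j. w j t * dev t X)\<^sup>2)}
     \<le> exp (- real (card J))"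
proof -
  define f where "f = (\<lambda>j X. exp ((\<Sum>t\<in>K j. w j t * dev t X)\<^sup>2 / 16))"
  have indep: "prob_space.indep_vars (measure_pmf Q) (\<lambda>_. borel) f J"
    by (rule indep_blocks[OF K]) (auto simp: f_def dev_def cong: sum.cong)
  have eq: "(\<Prod>j\<in>J. f j X) = exp ((\<Sum>j\<in>J. (\<Sum>t\<in>K j. w j t * dev t X)\<^sup>2) / 16)" for X
    by (simp add: f_def exp_sum J sum_divide_distrib)
  define c where "c = exp (sq_tail * real (card J) / 16)"
  have "measure_pmf.expectation Q (\<lambda>X. \<Prod>j\<in>J. f j X) = (\<Prod>j\<in>J. measure_pmf.expectation Q (f j))"
    by (rule prob_space.indep_vars_lebesgue_integral[OF measure_pmf.prob_space_axioms J indep]) simp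
  also have "\<dots> \<le> (\<Prod>j\<in>J. sq_moment)"
  proof (rule prod_mono)
    fix j assume "j \<in> J"
    then show "0 \<le> measure_pmf.expectation Q (f j) \<and> measure_pmf.expectation Q (f j) \<le> sq_moment"
      using exp_square_moment[OF K(1) w] by (auto simp: f_def)
  qed
  also have "\<dots> = exp (real (card J) * ln sq_moment)"
    using sq_moment_pos by (simp add: exp_of_nat_mult)
  finally have mom: "measure_pmf.expectation Q (\<lambda>X. \<Prod>j\<in>J. f j X) \<le> exp (real (card J) * ln sq_moment)" .
  have "{X. sq_tail * real (card J) \<le> (\<Sum>j\<in>J. (\<Sum>t\<in>K j. w j t * dev t X)\<^sup>2)}
      = {X. c \<le> (\<Prod>j\<in>J. f j X)}"
    unfolding eq c_def by simp
  moreover have "measure_pmf.prob Q {X \<in> space (measure_pmf Q). c \<le> (\<Prod>j\<in>J. f j X)}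
      \<le> (\<integral>X. (\<Prod>j\<in>J. f j X) \<partial>measure_pmf Q) / c"
    by (rule integral_Markov_inequality_measure[where A="{}"]) (auto simp: c_def f_def intro!: prod_nonneg)
  ultimately have "measure_pmf.prob Q {X. sq_tail * real (card J) \<le> (\<Sum>j\<in>J. (\<Sum>t\<in>K j. w j t * dev t X)\<^sup>2)}
      \<le> measure_pmf.expectation Q (\<lambda>X. \<Prod>j\<in>J. f j X) / c" by simp
  also have "\<dots> \<le> exp (real (card J) * ln sq_moment) / c"
    by (intro divide_right_mono mom) (simp add: c_def)
  also have "\<dots> = exp (- real (card J))"
    by (simp add: c_def sq_tail_def exp_diff[symmetric] algebra_simps)
  finally show ?thesis .
qed

end

section \<open>The noise matrix\<close>

definition pairs :: "nat \<Rightarrow> (nat \<times> nat) set" where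
  "pairs n = {(i, j). 1 \<le> i \<and> i < j \<and> j \<le> n}"

definition sym_mat :: "(nat \<times> nat \<Rightarrow> bool) \<Rightarrow> nat \<Rightarrow> nat \<Rightarrow> real" where
  "sym_mat X i j = (if i < j then (if X (i, j) then 1 else 0)
              else if j < i then (if X (j, i) then 1 else 0) else 0)"

lemma sym_mat_sym: "sym_mat X i j = sym_mat X j i"
  by (simp add: sym_mat_def)

lemma finite_pairs: "finite (pairs n)"
  by (rule finite_subset[of _ "{1..n} \<times> {1..n}"]) (auto simp: pairs_def)

text \<open>By symmetry the matrix of row products is the square of \<open>E\<close>, and |E x|^2 =
  <x, E^2 x> is at most the Frobenius norm of the square times |x|^2. The fourth power of
  \<open>c\<close> comes from taking square roots twice.\<close>

lemma form_via_square:
  assumes sym: "\<And>i j. E i j = E j i" and c: "0 \<le> c"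
    and fr: "frob n (\<lambda>i j. \<Sum>k=1..n. E i k * E j k) \<le> c ^ 4"
  shows "\<bar>dotp n x (mulv n E x)\<bar> \<le> c * dotp n x x"
proof -
  define E2 where "E2 = (\<lambda>i j. \<Sum>k=1..n. E i k * E j k)"
  have E2: "mulv n E2 x i = mulv n E (mulv n E x) i" for i
  proof -
    have "mulv n E2 x i = (\<Sum>j=1..n. \<Sum>k=1..n. E i k * (E k j * x j))"
      unfolding mulv_def E2_def by (simp add: sum_distrib_right sym[of _ "k::nat" for k] mult.assoc)
    also have "\<dots> = mulv n E (mulv n E x) i"
      by (subst sum.swap) (simp add: mulv_def sum_distrib_left)
    finally show ?thesis .
  qed
  have "dotp n (mulv n E x) (mulv n E x) = dotp n x (mulv n E2 x)"
    using dotp_mulv_sym[of E n x "mulv n E x"] sym E2 by (metis dotp_cong)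
  also have "\<dots> \<le> \<bar>dotp n x (mulv n E2 x)\<bar>" by simp
  also have "\<dots> \<le> c\<^sup>2 * dotp n x x"
    by (rule form_frob) (use fr in \<open>simp_all add: E2_def\<close>)
  finally have "dotp n (mulv n E x) (mulv n E x) \<le> c\<^sup>2 * dotp n x x" .
  then have "dotp n x x * dotp n (mulv n E x) (mulv n E x) \<le> dotp n x x * (c\<^sup>2 * dotp n x x)"
    by (rule mult_left_mono) simp
  then have "(dotp n x (mulv n E x))\<^sup>2 \<le> (c * dotp n x x)\<^sup>2"
    using dotp_Cauchy_Schwarz[of n x "mulv n E x"] by (simp add: power2_eq_square mult_ac)
  then show ?thesis
    using c abs_le_square_iff[of "dotp n x (mulv n E x)" "c * dotp n x x"] by simp
qed

locale random_matrix =
  fixes n :: nat and P :: "nat \<Rightarrow> nat \<Rightarrow> real"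
  assumes P_sym: "P i j = P j i" and P_diag: "P i i = 0" and P_01: "0 \<le> P i j" "P i j \<le> 1"
begin

sublocale bernoulli_field "pairs n" "\<lambda>(i, j). P i j"
  by unfold_locales (auto simp: finite_pairs P_01)

definition noise :: "(nat \<times> nat \<Rightarrow> bool) \<Rightarrow> nat \<Rightarrow> nat \<Rightarrow> real" where
  "noise X i j = sym_mat X i j - P i j"

definition pair :: "nat \<Rightarrow> nat \<Rightarrow> nat \<times> nat" where
  "pair i j = (min i j, max i j)"

lemma noise_sym: "noise X i j = noise X j i"
  by (simp add: noise_def sym_mat_sym[of X i j] P_sym[of i j])

lemma noise_diag: "noise X i i = 0"
  by (simp add: noise_def sym_mat_def P_diag)

lemma noise_dev: "i \<noteq> j \<Longrightarrow> noise X i j = dev (pair i j) X"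
  by (auto simp: noise_def dev_def pair_def sym_mat_def min_def max_def P_sym[of i j])

lemma noise_bound: "\<bar>noise X i j\<bar> \<le> 1"
  using P_01[of i j] by (auto simp: noise_def sym_mat_def)

lemma pair_in: "i \<in> {1..n} \<Longrightarrow> j \<in> {1..n} \<Longrightarrow> i \<noteq> j \<Longrightarrow> pair i j \<in> pairs n"
  by (auto simp: pair_def pairs_def min_def max_def)

lemma pair_eq_iff: "pair i j = pair k l \<longleftrightarrow> (i = k \<and> j = l) \<or> (i = l \<and> j = k)"
  by (auto simp: pair_def min_def max_def)

lemma rand_sym_eq: "rand_sym n P = map_pmf sym_mat Q"
  unfolding rand_sym_def Q_def pairs_def[symmetric] sym_mat_def[abs_def] by (simp add: case_prod_beta')

text \<open>The terms k = i and k = j vanish because the diagonal of the noise is zero. For the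
  other k the unordered pairs {i,k} and {j,k} are distinct and form disjoint blocks, so the products
  are independent, centred and bounded by 1.\<close>

lemma row_product_tail:
  assumes ij: "i \<in> {1..n}" "j \<in> {1..n}" "i \<noteq> j" and "0 \<le> x"
  shows "measure_pmf.prob Q {X. x \<le> \<bar>\<Sum>k=1..n. noise X i k * noise X j k\<bar>} \<le> 2 * exp (- x\<^sup>2 / (2 * real n))"
proof -
  define L where "L = {1..n} - {i, j}"
  have eq: "(\<Sum>k=1..n. noise X i k * noise X j k) = (\<Sum>k\<in>L. dev (pair i k) X * dev (pair j k) X)" for X
  proof -
    have "(\<Sum>k=1..n. noise X i k * noise X j k) = (\<Sum>k\<in>L. noise X i k * noise X j k)"
      by (rule sum.mono_neutral_right) (auto simp: L_def noise_diag)
    also have "\<dots> = (\<Sum>k\<in>L. dev (pair i k) X * dev (pair j k) X)"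
      by (rule sum.cong) (auto simp: L_def noise_dev)
    finally show ?thesis .
  qed
  have n: "0 < real n" using ij by auto
  have "measure_pmf.prob Q {X. x \<le> \<bar>\<Sum>k\<in>L. dev (pair i k) X * dev (pair j k) X\<bar>} \<le> 2 * exp (- x\<^sup>2 / (2 * real n))"
  proof (rule hoeffding_blocks[where K="\<lambda>k. {pair i k, pair j k}" and c="\<lambda>_. 1"])
    show "finite L" by (simp add: L_def)
    show "{pair i k, pair j k} \<subseteq> pairs n" if "k \<in> L" for k
      using that ij by (auto simp: L_def intro!: pair_in)
    show "disjoint_family_on (\<lambda>k. {pair i k, pair j k}) L"
      using ij by (auto simp: disjoint_family_on_def pair_eq_iff L_def)
    show "dev (pair i k) X * dev (pair j k) X = dev (pair i k) Y * dev (pair j k) Y"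
      if "\<And>t. t \<in> {pair i k, pair j k} \<Longrightarrow> X t = Y t" for k X Y
      using that by (simp add: dev_def)
    show "\<bar>dev (pair i k) X * dev (pair j k) X\<bar> \<le> 1" if "k \<in> L" for k X
      using that ij by (auto simp: L_def abs_mult intro!: mult_le_one dev_bound pair_in)
    show "measure_pmf.expectation Q (\<lambda>X. dev (pair i k) X * dev (pair j k) X) = 0" if "k \<in> L" for k
      using that ij by (intro expectation_dev_mult pair_in) (auto simp: L_def pair_eq_iff)
    show "(\<Sum>k\<in>L. 1\<^sup>2) \<le> real n"
      using card_mono[of "{1..n}" L] by (simp add: L_def)
  qed (use n assms in auto)
  then show ?thesis by (simp only: eq)
qed

lemma rows_product_tail:
  assumes "0 \<le> x"
  shows "measure_pmf.prob Q {X. \<exists>i\<in>{1..n}. \<exists>j\<in>{1..n}. i \<noteq> j \<and> x \<le> \<bar>\<Sum>k=1..n. noise X i k * noise X j k\<bar>}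
    \<le> 2 * (real n)\<^sup>2 * exp (- x\<^sup>2 / (2 * real n))"
proof -
  define S where "S = {(i, j) \<in> {1..n} \<times> {1..n}. i \<noteq> j}"
  define B where "B = (\<lambda>(i, j). {X. x \<le> \<bar>\<Sum>k=1..n. noise X i k * noise X j k\<bar>})"
  have finS: "finite S" by (rule finite_subset[of _ "{1..n} \<times> {1..n}"]) (auto simp: S_def)
  have "card S \<le> card ({1..n} \<times> {1..n})" by (rule card_mono) (auto simp: S_def)
  then have cS: "real (card S) \<le> (real n)\<^sup>2" by (simp add: power2_eq_square flip: of_nat_mult)
  have "{X. \<exists>i\<in>{1..n}. \<exists>j\<in>{1..n}. i \<noteq> j \<and> x \<le> \<bar>\<Sum>k=1..n. noise X i k * noise X j k\<bar>} = (\<Union>t\<in>S. B t)"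
    unfolding S_def B_def by blast
  also have "measure_pmf.prob Q (\<Union>t\<in>S. B t) \<le> (\<Sum>t\<in>S. measure_pmf.prob Q (B t))"
    by (rule measure_pmf.finite_measure_subadditive_finite[OF finS]) auto
  also have "\<dots> \<le> (\<Sum>t\<in>S. 2 * exp (- x\<^sup>2 / (2 * real n)))"
  proof (rule sum_mono)
    fix t assume "t \<in> S"
    then obtain i j where "t = (i, j)" "i \<in> {1..n}" "j \<in> {1..n}" "i \<noteq> j" by (auto simp: S_def)
    then show "measure_pmf.prob Q (B t) \<le> 2 * exp (- x\<^sup>2 / (2 * real n))"
      using row_product_tail[OF _ _ _ assms] by (simp only: B_def prod.case)
  qed
  also have "\<dots> = real (card S) * (2 * exp (- x\<^sup>2 / (2 * real n)))" by simp
  also have "\<dots> \<le> (real n)\<^sup>2 * (2 * exp (- x\<^sup>2 / (2 * real n)))"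
    by (rule mult_right_mono[OF cS]) simp
  finally show ?thesis by simp
qed

text \<open>Diagonal entries are sums of squares without cancellation and get the trivial bound n,
  for a total of n^3; \<open>x\<close> is used for the others.\<close>

lemma frob_square_noise:
  assumes "\<And>i j. i \<in> {1..n} \<Longrightarrow> j \<in> {1..n} \<Longrightarrow> i \<noteq> j \<Longrightarrow> \<bar>\<Sum>k=1..n. noise X i k * noise X j k\<bar> \<le> x"
  shows "frob n (\<lambda>i j. \<Sum>k=1..n. noise X i k * noise X j k) \<le> (real n) ^ 3 + (real n)\<^sup>2 * x\<^sup>2"
proof -
  have ent: "(\<Sum>k=1..n. noise X i k * noise X j k)\<^sup>2 \<le> (if i = j then (real n)\<^sup>2 else 0) + x\<^sup>2"
    if ij: "i \<in> {1..n}" "j \<in> {1..n}" for i j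
  proof (cases "i = j")
    case True
    have "\<bar>\<Sum>k=1..n. noise X i k * noise X j k\<bar> \<le> (\<Sum>k=1..n. 1)"
      by (rule order.trans[OF sum_abs])
        (intro sum_mono, simp add: abs_mult mult_le_one noise_bound)
    then have "(\<Sum>k=1..n. noise X i k * noise X j k)\<^sup>2 \<le> (real n)\<^sup>2"
      using abs_le_square_iff[of "\<Sum>k=1..n. noise X i k * noise X j k" "real n"] by simp
    then show ?thesis using True by (simp add: add_increasing2)
  next
    case False
    then show ?thesis using power_mono[OF assms[OF ij], of 2] by simp
  qed
  have "frob n (\<lambda>i j. \<Sum>k=1..n. noise X i k * noise X j k)
      \<le> (\<Sum>i=1..n. \<Sum>j=1..n. (if i = j then (real n)\<^sup>2 else 0) + x\<^sup>2)"
    unfolding frob_def by (intro sum_mono ent)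
  also have "\<dots> = (\<Sum>i=1..n. (real n)\<^sup>2 + real n * x\<^sup>2)"
    by (rule sum.cong) (simp_all add: sum.distrib)
  also have "\<dots> = (real n) ^ 3 + (real n)\<^sup>2 * x\<^sup>2"
    by (simp add: algebra_simps power2_eq_square power3_eq_cube)
  finally show ?thesis .
qed

text \<open>The two triangular halves of the noise are treated separately, since each has independent
  rows.\<close>
lemma noise_vector_tail:
  assumes w: "dotp n w w \<le> 1"
  shows "measure_pmf.prob Q {X. 4 * sq_tail * real n \<le> dotp n (mulv n (noise X) w) (mulv n (noise X) w)}
     \<le> 2 * exp (- real n)"
proof -
  define U where "U = (\<lambda>i X. \<Sum>j\<in>{i<..n}. w j * dev (i, j) X)"
  define L where "L = (\<lambda>i X. \<Sum>j\<in>{1..<i}. w j * dev (j, i) X)"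
  have split: "mulv n (noise X) w i = U i X + L i X" if i: "i \<in> {1..n}" for i X
  proof -
    have "mulv n (noise X) w i = (\<Sum>j\<in>{i<..n} \<union> {1..<i}. noise X i j * w j)"
      unfolding mulv_def by (rule sum.mono_neutral_right) (use i in \<open>auto simp: noise_diag\<close>)
    also have "\<dots> = (\<Sum>j\<in>{i<..n}. noise X i j * w j) + (\<Sum>j\<in>{1..<i}. noise X i j * w j)"
      by (rule sum.union_disjoint) auto
    also have "(\<Sum>j\<in>{i<..n}. noise X i j * w j) = U i X"
      unfolding U_def by (rule sum.cong) (auto simp: noise_dev pair_def)
    also have "(\<Sum>j\<in>{1..<i}. noise X i j * w j) = L i X"
      unfolding L_def by (rule sum.cong) (auto simp: noise_dev pair_def)
    finally show ?thesis .
  qed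
  have w_sub: "(\<Sum>j\<in>J. (w j)\<^sup>2) \<le> 1" if "J \<subseteq> {1..n}" for J
    using sum_mono2[of "{1..n}" J "\<lambda>j. (w j)\<^sup>2"] that w by (simp add: dotp_self)
  have U: "U i X = (\<Sum>t\<in>Pair i ` {i<..n}. w (snd t) * dev t X)" for i X
    unfolding U_def by (subst sum.reindex) (auto simp: inj_on_def)
  have L: "L i X = (\<Sum>t\<in>(\<lambda>j. (j, i)) ` {1..<i}. w (fst t) * dev t X)" for i X
    unfolding L_def by (subst sum.reindex) (auto simp: inj_on_def)
  have PU: "measure_pmf.prob Q {X. sq_tail * real (card {1..n}) \<le> (\<Sum>i=1..n. (U i X)\<^sup>2)} \<le> exp (- real (card {1..n}))"
    unfolding U
  proof (rule sum_squares_tail)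
    show "Pair i ` {i<..n} \<subseteq> pairs n" if "i \<in> {1..n}" for i using that by (auto simp: pairs_def)
    show "(\<Sum>t\<in>Pair i ` {i<..n}. (w (snd t))\<^sup>2) \<le> 1" for i
      by (subst sum.reindex) (auto simp: inj_on_def intro!: w_sub)
  qed (auto simp: disjoint_family_on_def)
  have PL: "measure_pmf.prob Q {X. sq_tail * real (card {1..n}) \<le> (\<Sum>i=1..n. (L i X)\<^sup>2)} \<le> exp (- real (card {1..n}))"
    unfolding L
  proof (rule sum_squares_tail)
    show "(\<lambda>j. (j, i)) ` {1..<i} \<subseteq> pairs n" if "i \<in> {1..n}" for i using that by (auto simp: pairs_def)
    show "(\<Sum>t\<in>(\<lambda>j. (j, i)) ` {1..<i}. (w (fst t))\<^sup>2) \<le> 1" if "i \<in> {1..n}" for i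
      using that by (subst sum.reindex) (auto simp: inj_on_def intro!: w_sub)
  qed (auto simp: disjoint_family_on_def)
  have norm: "dotp n (mulv n (noise X) w) (mulv n (noise X) w) \<le> 2 * (\<Sum>i=1..n. (U i X)\<^sup>2) + 2 * (\<Sum>i=1..n. (L i X)\<^sup>2)" for X
  proof -
    have "dotp n (mulv n (noise X) w) (mulv n (noise X) w) = (\<Sum>i=1..n. (U i X + L i X)\<^sup>2)"
      unfolding dotp_self by (rule sum.cong) (simp_all add: split)
    also have "\<dots> \<le> (\<Sum>i=1..n. 2 * (U i X)\<^sup>2 + 2 * (L i X)\<^sup>2)"
    proof (rule sum_mono)
      fix i show "(U i X + L i X)\<^sup>2 \<le> 2 * (U i X)\<^sup>2 + 2 * (L i X)\<^sup>2"
        using zero_le_power2[of "U i X - L i X"] by (simp add: power2_eq_square algebra_simps)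
    qed
    finally show ?thesis by (simp add: sum.distrib sum_distrib_left)
  qed
  have "measure_pmf.prob Q {X. 4 * sq_tail * real n \<le> dotp n (mulv n (noise X) w) (mulv n (noise X) w)}
     \<le> measure_pmf.prob Q ({X. sq_tail * real n \<le> (\<Sum>i=1..n. (U i X)\<^sup>2)} \<union> {X. sq_tail * real n \<le> (\<Sum>i=1..n. (L i X)\<^sup>2)})"
  proof (rule measure_pmf.finite_measure_mono)
    show "{X. 4 * sq_tail * real n \<le> dotp n (mulv n (noise X) w) (mulv n (noise X) w)}
      \<subseteq> {X. sq_tail * real n \<le> (\<Sum>i=1..n. (U i X)\<^sup>2)} \<union> {X. sq_tail * real n \<le> (\<Sum>i=1..n. (L i X)\<^sup>2)}"
    proof
      fix X assume "X \<in> {X. 4 * sq_tail * real n \<le> dotp n (mulv n (noise X) w) (mulv n (noise X) w)}"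
      with norm[of X] have "4 * (sq_tail * real n) \<le> 2 * (\<Sum>i=1..n. (U i X)\<^sup>2) + 2 * (\<Sum>i=1..n. (L i X)\<^sup>2)" by simp
      then have "sq_tail * real n \<le> (\<Sum>i=1..n. (U i X)\<^sup>2) \<or> sq_tail * real n \<le> (\<Sum>i=1..n. (L i X)\<^sup>2)" by linarith
      then show "X \<in> {X. sq_tail * real n \<le> (\<Sum>i=1..n. (U i X)\<^sup>2)} \<union> {X. sq_tail * real n \<le> (\<Sum>i=1..n. (L i X)\<^sup>2)}" by simp
    qed
  qed simp
  also have "\<dots> \<le> exp (- real n) + exp (- real n)"
    using PU PL by (intro order.trans[OF measure_Un_le] add_mono) auto
  finally show ?thesis by simp
qed

end

section \<open>Counting inverted pairs\<close>

text \<open>A weak form of Jordan's inequality: the cubic Maclaurin bound together with x^2 \<le> 4.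
  The loss against 2 / pi only affects the final constant.\<close>

lemma sin_ge_third:
  assumes "0 \<le> x" "x \<le> pi / 2" shows "x / 3 \<le> sin (x :: real)"
proof -
  have "\<bar>sin x - (\<Sum>m<3. sin_coeff m * x ^ m)\<bar> \<le> inverse (fact 3) * \<bar>x\<bar> ^ 3"
    by (rule Maclaurin_sin_bound)
  moreover have "(\<Sum>m<3. sin_coeff m * x ^ m) = x"
    by (simp add: sin_coeff_def eval_nat_numeral)
  ultimately have "\<bar>sin x - x\<bar> \<le> x ^ 3 / 6"
    using assms by (simp add: fact_numeral)
  then have "x - x ^ 3 / 6 \<le> sin x" by linarith
  moreover have "x ^ 3 \<le> 4 * x"
  proof -
    have "x * x \<le> 2 * 2" using assms pi_less_4 by (intro mult_mono) auto
    then have "x * (x * x) \<le> x * 4" using assms by (intro mult_left_mono) auto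
    then show ?thesis by (simp add: power3_eq_cube)
  qed
  ultimately show ?thesis by simp
qed

text \<open>The angle whose cosine is the entry of \<open>u_vec\<close>. Consecutive angles differ
  by 2 phi, except for a jump of 4 phi over the omitted sample at pi / 2.\<close>

definition theta :: "nat \<Rightarrow> nat \<Rightarrow> real" where
  "theta s i = (if i \<le> s then 2 * real i - 1 else 2 * real i + 1) * phi s"

lemma u_vec_theta: "i \<le> 2 * s \<Longrightarrow> u_vec s i = cos (theta s i)"
  by (simp add: theta_def u_vec_low u_vec_high)

lemma theta_bounds: "(2 * real i - 1) * phi s \<le> theta s i" "theta s i \<le> (2 * real i + 1) * phi s"
  using phi_pos[of s] by (auto simp: theta_def)

lemma theta_diff: "i \<le> j \<Longrightarrow> 2 * (real j - real i) * phi s \<le> theta s j - theta s i"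
  using phi_pos[of s] by (auto simp: theta_def algebra_simps)

text \<open>A difference of cosines is twice the product of the sines of half the difference and of
  the mean of the angles. Half the difference is at least k phi, and the mean keeps distance r phi
  from both 0 and pi.\<close>

lemma u_vec_gap:
  assumes s: "s \<ge> 1" and ij: "j \<le> 2 * s" "real i + k \<le> real j" and k: "0 \<le> k"
    and r: "1 \<le> r" "r \<le> real i" "real j \<le> 2 * real s - r"
  shows "k * r / (8 * (2 * real s)\<^sup>2) \<le> u_vec s i - u_vec s j"
proof -
  define f where "f = phi s"
  have f: "0 < f" and f_mult: "(4 * real s + 2) * f = pi" using phi_pos phi_mult by (simp_all add: f_def)
  define h where "h = (theta s j - theta s i) / 2"
  define \<psi> where "\<psi> = (theta s i + theta s j) / 2"
  have le: "i \<le> j" using ij k by linarith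
  have up: "theta s j \<le> pi - (2 * r + 1) * f"
  proof -
    have "(2 * real j + 1) * f \<le> (4 * real s - 2 * r + 1) * f"
      by (rule mult_right_mono) (use r f in auto)
    then show ?thesis using theta_bounds(2)[of s j] f_mult by (simp add: f_def algebra_simps)
  qed
  have low: "(2 * r - 1) * f \<le> theta s i"
  proof -
    have "(2 * r - 1) * f \<le> (2 * real i - 1) * f"
      by (rule mult_right_mono) (use r f in auto)
    then show ?thesis using theta_bounds(1)[of i s] by (simp add: f_def)
  qed
  have rf: "f \<le> r * f" using r f by simp
  have "2 * k * f \<le> 2 * (real j - real i) * f"
    by (rule mult_right_mono) (use ij f in auto)
  then have h_low: "k * f \<le> h" using theta_diff[OF le, of s] by (simp add: h_def f_def)
  have "theta s j - theta s i \<le> pi" using up low rf f unfolding distrib_right left_diff_distrib by linarith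
  then have "h \<le> pi / 2" by (simp add: h_def)
  moreover have "0 \<le> k * f" using k f by simp
  ultimately have sin_h: "k * f / 3 \<le> sin h" using sin_ge_third[of h] h_low by linarith
  have "theta s i \<le> theta s j" using theta_diff[OF le, of s] le phi_pos[of s]
    by (smt (verit) mult_nonneg_nonneg of_nat_mono)
  then have \<psi>: "theta s i \<le> \<psi>" "\<psi> \<le> theta s j" by (simp_all add: \<psi>_def)
  have \<psi>1: "r * f \<le> \<psi>" "r * f \<le> pi - \<psi>"
    using \<psi> up low rf f unfolding distrib_right left_diff_distrib by linarith+
  have sin_\<psi>: "r * f / 3 \<le> sin \<psi>"
  proof (cases "\<psi> \<le> pi / 2")
    case True
    then show ?thesis using sin_ge_third[of \<psi>] \<psi>1 rf f by linarith
  next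
    case False
    then have "(pi - \<psi>) / 3 \<le> sin (pi - \<psi>)"
      using \<psi>1 rf f by (intro sin_ge_third) linarith+
    then show ?thesis using \<psi>1 by simp
  qed
  \<comment> \<open>As 4 s + 2 \<le> 8 s and pi > 3, phi / 3 is at least 1 / (8 s); two such factors
    and the 2 of the product formula give k r / (32 s^2), the claimed bound.\<close>
  have "3 \<le> 8 * real s * f"
  proof -
    have "(4 * real s + 2) * f \<le> (8 * real s) * f"
      by (rule mult_right_mono) (use s f in auto)
    then show ?thesis using f_mult pi_gt3 by linarith
  qed
  then have "1 / (8 * real s) \<le> f / 3" using s by (simp add: field_simps)
  then have "(1 / (8 * real s))\<^sup>2 \<le> (f / 3)\<^sup>2" by (rule power_mono) simp
  then have "2 * (k * r) * (1 / (8 * real s))\<^sup>2 \<le> 2 * (k * r) * (f / 3)\<^sup>2"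
    using k r by (intro mult_left_mono) auto
  also have "\<dots> = 2 * (r * f / 3) * (k * f / 3)" by (simp add: power2_eq_square)
  also have "\<dots> \<le> 2 * sin \<psi> * sin h"
  proof (intro mult_mono)
    have "0 \<le> r * f / 3" using r f by simp
    then show "0 \<le> 2 * sin \<psi>" using sin_\<psi> by linarith
  qed (use sin_\<psi> sin_h k r f in auto)
  also have "\<dots> = u_vec s i - u_vec s j"
    using le ij(1) by (simp add: u_vec_theta cos_diff_cos h_def \<psi>_def)
  finally show ?thesis by (simp add: power2_eq_square)
qed

lemma card_Markov_sq:
  fixes d :: "nat \<Rightarrow> real"
  assumes "0 < t"
  shows "real (card {i \<in> {1..n}. t \<le> \<bar>d i\<bar>}) * t\<^sup>2 \<le> dotp n d d"
proof -
  have "real (card {i \<in> {1..n}. t \<le> \<bar>d i\<bar>}) * t\<^sup>2 = (\<Sum>i\<in>{i \<in> {1..n}. t \<le> \<bar>d i\<bar>}. t\<^sup>2)" by simp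
  also have "\<dots> \<le> (\<Sum>i\<in>{i \<in> {1..n}. t \<le> \<bar>d i\<bar>}. (d i)\<^sup>2)"
    using assms abs_le_square_iff by (intro sum_mono) fastforce
  also have "\<dots> \<le> dotp n d d"
    unfolding dotp_self by (rule sum_mono2) auto
  finally show ?thesis .
qed

lemma D_count_bound:
  fixes \<beta> G :: real
  defines "n \<equiv> (\<lambda>s. 2 * s)"
  assumes s: "s \<ge> 1" and \<beta>: "0 \<le> \<beta>" "\<beta> < 1"
    and close: "dotp (n s) (\<lambda>i. y i - u_unit s i) (\<lambda>i. y i - u_unit s i) \<le> G / real (n s)"
  shows "real (D_count (n s) (real (n s) powr \<beta>) 1 y) \<le> (3 + 512 * G) * real (n s) powr ((7 - 2 * \<beta>) / 3)"
proof -
  define N where "N = n s"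
  define nr where "nr = real N"
  define k where "k = nr powr \<beta>"
  define r where "r = nr powr ((4 - 2 * \<beta>) / 3)"
  \<comment> \<open>Half of the gap from \<open>u_vec_gap\<close> after division by the norm of
    \<open>u_vec\<close>, which is at most sqrt n.\<close>
  define t where "t = k * r / (16 * nr\<^sup>2 * sqrt nr)"
  define d where "d = (\<lambda>i. y i - u_unit s i)"
  have N: "N \<ge> 2" "nr = 2 * real s" using s by (simp_all add: N_def nr_def n_def)
  then have nr: "nr \<ge> 2" by (simp add: nr_def)
  have k: "k > 0" using nr by (simp add: k_def)
  have r: "r \<ge> 1" using nr \<beta> by (simp add: r_def ge_one_powr_ge_zero)
  have t: "t > 0" using k r nr by (simp add: t_def)
  \<comment> \<open>The balancing identity. Chebyshev leaves at most 256 G n^4 / (k r)^2 bad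
    indices, and this identity says that n^4 / (k r)^2 = r, the order of the number of indices near
    the ends.\<close>
  have k2r3: "k\<^sup>2 * r ^ 3 = nr ^ 4"
  proof -
    have "k\<^sup>2 * r ^ 3 = nr powr (2 * \<beta>) * nr powr (3 * ((4 - 2 * \<beta>) / 3))"
      using nr by (simp add: k_def r_def powr_power mult_ac)
    also have "\<dots> = nr powr 4" unfolding powr_add[symmetric] by (simp add: field_simps)
    finally show ?thesis using nr by simp
  qed
  have nr_r: "nr * r = nr powr ((7 - 2 * \<beta>) / 3)"
  proof -
    have "nr * r = nr powr 1 * nr powr ((4 - 2 * \<beta>) / 3)" using nr by (simp add: r_def)
    also have "\<dots> = nr powr ((7 - 2 * \<beta>) / 3)" unfolding powr_add[symmetric] by (simp add: field_simps)
    finally show ?thesis .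
  qed
  define Low where "Low = {i \<in> {1..N}. real i < r}"
  define High where "High = {j \<in> {1..N}. nr - r < real j}"
  define Bad where "Bad = {i \<in> {1..N}. t \<le> \<bar>d i\<bar>}"
  have "Low \<subseteq> {1..nat \<lfloor>r\<rfloor>}" by (auto simp: Low_def le_nat_floor)
  then have "card Low \<le> nat \<lfloor>r\<rfloor>" using card_mono[of "{1..nat \<lfloor>r\<rfloor>}" Low] by simp
  then have cLow: "real (card Low) \<le> r" using r by linarith
  \<comment> \<open>The last index lies in \<open>High\<close> too, so the count is floor r + 1 and
    not floor r; as r \<ge> 1 this is at most 2 r. With r from \<open>Low\<close> it makes the 3 of
    the final constant, while bad indices in either position give 2 * 256 G.\<close>
  have "High \<subseteq> {N - nat \<lfloor>r\<rfloor>..N}"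
  proof
    fix j assume j: "j \<in> High"
    then have "real (N - j) \<le> r" "j \<le> N" by (auto simp: High_def nr_def of_nat_diff)
    then have "N - j \<le> nat \<lfloor>r\<rfloor>" by (simp add: le_nat_floor)
    then show "j \<in> {N - nat \<lfloor>r\<rfloor>..N}" using \<open>j \<le> N\<close> by auto
  qed
  then have "card High \<le> Suc N - (N - nat \<lfloor>r\<rfloor>)" using card_mono[of "{N - nat \<lfloor>r\<rfloor>..N}" High] by simp
  then have "card High \<le> nat \<lfloor>r\<rfloor> + 1" by linarith
  then have cHigh: "real (card High) \<le> 2 * r" using r by linarith
  have "real (card Bad) * t\<^sup>2 \<le> G / nr"
    using card_Markov_sq[OF t, of N d] close by (simp add: Bad_def d_def N_def nr_def)
  also have "G / nr = 256 * G * r * t\<^sup>2"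
  proof -
    have "t\<^sup>2 = k\<^sup>2 * r\<^sup>2 / (256 * nr ^ 5)"
      using nr by (simp add: t_def power_divide power_mult_distrib flip: power_mult power_Suc)
        (simp add: eval_nat_numeral)
    then have "256 * G * r * t\<^sup>2 = G * (k\<^sup>2 * r ^ 3) / nr ^ 5"
      by (simp add: eval_nat_numeral)
    then show ?thesis using nr unfolding k2r3 by (simp add: eval_nat_numeral)
  qed
  finally have cBad: "real (card Bad) \<le> 256 * G * r" using t by simp
  have sub: "{(i, j). i \<in> {1..N} \<and> j \<in> {1..N} \<and> y j > y i \<and> real i + k \<le> real j \<and> 1 \<le> real i}
     \<subseteq> Low \<times> {1..N} \<union> {1..N} \<times> High \<union> Bad \<times> {1..N} \<union> {1..N} \<times> Bad"
    (is "_ \<subseteq> ?cover")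
  proof
    fix z assume "z \<in> {(i, j). i \<in> {1..N} \<and> j \<in> {1..N} \<and> y j > y i \<and> real i + k \<le> real j \<and> 1 \<le> real i}"
    then obtain i j where z: "z = (i, j)"
      and ij: "i \<in> {1..N}" "j \<in> {1..N}" "y i < y j" "real i + k \<le> real j" by blast
    show "z \<in> ?cover"
    proof (rule ccontr)
      assume notin: "z \<notin> ?cover"
      then have reg: "r \<le> real i" "real j \<le> 2 * real s - r" and bad: "\<bar>d i\<bar> < t" "\<bar>d j\<bar> < t"
        using z ij N by (auto simp: Low_def High_def Bad_def)
      define m where "m = sqrt (dotp (2 * s) (u_vec s) (u_vec s))"
      have m: "0 < m" "m \<le> sqrt nr" using u_norm_pos[OF s] u_norm_le[of s] N by (simp_all add: m_def)
      have gap: "k * r / (8 * nr\<^sup>2) \<le> u_vec s i - u_vec s j"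
        using u_vec_gap[OF s _ ij(4) _ r reg] ij(2) k N by (simp add: N_def n_def)
      have "2 * t = k * r / (8 * nr\<^sup>2) / sqrt nr" by (simp add: t_def)
      also have "\<dots> \<le> k * r / (8 * nr\<^sup>2) / m"
        using m k r nr by (intro divide_left_mono) auto
      also have "\<dots> \<le> (u_vec s i - u_vec s j) / m" using gap m by (intro divide_right_mono) auto
      also have "\<dots> = u_unit s i - u_unit s j" by (simp add: u_unit_def m_def diff_divide_distrib)
      finally show False using bad ij(3) by (simp add: d_def)
    qed
  qed
  have "D_count N k 1 y \<le> card (Low \<times> {1..N} \<union> {1..N} \<times> High \<union> Bad \<times> {1..N} \<union> {1..N} \<times> Bad)"
    unfolding D_count_def by (rule card_mono[OF _ sub]) (auto simp: Low_def High_def Bad_def)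
  also have "\<dots> \<le> card (Low \<times> {1..N}) + card ({1..N} \<times> High) + card (Bad \<times> {1..N}) + card ({1..N} \<times> Bad)"
    by (intro order.trans[OF card_Un_le] add_mono order.refl)
  also have "\<dots> = N * (card Low + card High + 2 * card Bad)"
    by (simp add: card_cartesian_product algebra_simps)
  finally have "real (D_count N k 1 y) \<le> nr * (real (card Low) + real (card High) + 2 * real (card Bad))"
    unfolding nr_def using of_nat_mono by fastforce
  also have "\<dots> \<le> nr * ((3 + 512 * G) * r)"
    using cLow cHigh cBad nr by (intro mult_left_mono) (auto simp: algebra_simps)
  also have "\<dots> = (3 + 512 * G) * nr powr ((7 - 2 * \<beta>) / 3)"
    by (simp flip: nr_r)
  finally show ?thesis
    by (simp only: N_def nr_def k_def)
qed

section \<open>Proof of the theorem\<close>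

lemma random_matrix_bandM:
  assumes "s \<ge> 1" "0 < p" "p < 1"
  shows "random_matrix (bandM s p)"
  by unfold_locales (use assms in \<open>auto simp: bandM_def abs_minus_commute\<close>)

lemma D_count_trivial: "real (D_count n k r y) \<le> (real n)\<^sup>2"
proof -
  have "D_count n k r y \<le> card ({1..n} \<times> {1..n})"
    unfolding D_count_def by (rule card_mono) auto
  then show ?thesis by (simp add: power2_eq_square card_cartesian_product flip: of_nat_mult)
qed

lemma D_count_far:
  assumes "1 \<le> \<beta>" "n \<ge> 1"
  shows "D_count n (real n powr \<beta>) 1 y = 0"
proof -
  have "real n powr 1 \<le> real n powr \<beta>" by (rule powr_mono) (use assms in auto)
  then have "real n \<le> real n powr \<beta>" using assms by simp
  then have empty: "\<not> (i \<in> {1..n} \<and> j \<in> {1..n} \<and> real i + real n powr \<beta> \<le> real j)" for i j by auto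
  then have "{(i, j). i \<in> {1..n} \<and> j \<in> {1..n} \<and> y j > y i \<and> real i + real n powr \<beta> \<le> real j \<and> 1 \<le> real i} = {}"
    by blast
  then show ?thesis by (simp only: D_count_def) simp
qed

text \<open>With \<open>\<eta> = p / 200\<close>, the two bad events are that two rows of the noise have inner product
  at least \<open>\<eta>\<^sup>2 n / 2\<close>, and that the noise moves the unit vector u by at least \<open>2 * sqrt (sq_tail * n)\<close>.\<close>
lemma second_eigvec_close_whp:
  fixes p :: real
  assumes p: "0 < p" "p < 1"
  defines "G \<equiv> 320000 * sq_tail / p\<^sup>2"
  shows "\<exists>S. \<forall>s\<ge>S. measure_pmf.prob (rand_sym (2 * s) (bandM s p))
      {A. \<forall>lam y. second_eigenvalue (2 * s) A lam \<and> is_eigvec (2 * s) A lam y \<and>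
            dotp (2 * s) y y = 1 \<and> dotp (2 * s) y (u_vec s) \<ge> 0 \<longrightarrow>
            dotp (2 * s) (\<lambda>i. y i - u_unit s i) (\<lambda>i. y i - u_unit s i) \<le> G / real (2 * s)}
      \<ge> 1 - real (2 * s) powr (-3)"
proof -
  define \<eta> where "\<eta> = p / 200"
  have \<eta>: "0 < \<eta>" using p by (simp add: \<eta>_def)
  \<comment> \<open>With x = \<eta>^2 n / 2 the Hoeffding exponent x^2 / (2 n) equals \<eta>^4 n /
    8.\<close>
  define a where "a = \<eta> ^ 4 / 8"
  have a: "0 < a" using \<eta> by (simp add: a_def)
  have "eventually (\<lambda>x::real. 2 * x\<^sup>2 * exp (- a * x) + 2 * exp (- x) \<le> x powr (-3)) at_top"
  proof -
    have "eventually (\<lambda>x::real. 2 * x\<^sup>2 * exp (- a * x) \<le> x powr (-3) / 2) at_top"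
      using a by real_asymp
    moreover have "eventually (\<lambda>x::real. 2 * exp (- x) \<le> x powr (-3) / 2) at_top"
      by real_asymp
    ultimately show ?thesis by eventually_elim linarith
  qed
  then obtain X0 where X0: "\<And>x. x \<ge> X0 \<Longrightarrow> 2 * x\<^sup>2 * exp (- a * x) + 2 * exp (- x) \<le> x powr (-3)"
    by (auto simp: eventually_at_top_linorder)
  \<comment> \<open>The thresholds serve, in turn, the numerical gap estimates, the comparison of
    the tails with n^(-3), and the absorption of the diagonal term n^3.\<close>
  define S where "S = nat \<lceil>max 500 (max X0 (2 / \<eta> ^ 4))\<rceil>"
  show ?thesis
  proof (intro exI[of _ S] allI impI)
    fix s assume "s \<ge> S"
    then have "real S \<le> real s" by simp
    moreover have "max 500 (max X0 (2 / \<eta> ^ 4)) \<le> real S" unfolding S_def by linarith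
    ultimately have big: "500 \<le> real s" "X0 \<le> real s" "2 / \<eta> ^ 4 \<le> real s" by linarith+
    then have s: "s \<ge> 500" by simp
    define n where "n = 2 * s"
    define nr where "nr = real n"
    have nr: "nr = 2 * real s" "nr > 0" using s by (simp_all add: nr_def n_def)
    interpret random_matrix n "bandM s p"
      using random_matrix_bandM p s by simp
    define x where "x = \<eta>\<^sup>2 / 2 * nr"
    define B1 where "B1 = {X. \<exists>i\<in>{1..n}. \<exists>j\<in>{1..n}. i \<noteq> j \<and> x \<le> \<bar>\<Sum>k=1..n. noise X i k * noise X j k\<bar>}"
    define B2 where "B2 = {X. 4 * sq_tail * real n \<le> dotp n (mulv n (noise X) (u_unit s)) (mulv n (noise X) (u_unit s))}"
    define Ev where "Ev = {A. \<forall>lam y. second_eigenvalue (2 * s) A lam \<and> is_eigvec (2 * s) A lam y \<and>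
            dotp (2 * s) y y = 1 \<and> dotp (2 * s) y (u_vec s) \<ge> 0 \<longrightarrow>
            dotp (2 * s) (\<lambda>i. y i - u_unit s i) (\<lambda>i. y i - u_unit s i) \<le> G / real (2 * s)}"
    have "measure_pmf.prob Q B1 \<le> 2 * nr\<^sup>2 * exp (- x\<^sup>2 / (2 * nr))"
      unfolding B1_def nr_def by (rule rows_product_tail) (use nr \<eta> in \<open>simp add: x_def\<close>)
    also have "- x\<^sup>2 / (2 * nr) = - a * nr"
      using nr by (simp add: x_def a_def power2_eq_square eval_nat_numeral)
    finally have PB1: "measure_pmf.prob Q B1 \<le> 2 * nr\<^sup>2 * exp (- a * nr)" .
    have PB2: "measure_pmf.prob Q B2 \<le> 2 * exp (- nr)"
      unfolding B2_def nr_def by (rule noise_vector_tail) (use u_unit_norm[of s] s in \<open>simp add: n_def\<close>)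
    have "measure_pmf.prob Q (B1 \<union> B2) \<le> measure_pmf.prob Q B1 + measure_pmf.prob Q B2"
      by (rule measure_Un_le) auto
    also have "\<dots> \<le> nr powr (-3)" using PB1 PB2 X0[of nr] nr big by linarith
    finally have bad: "measure_pmf.prob Q (B1 \<union> B2) \<le> nr powr (-3)" .
    have good: "sym_mat X \<in> Ev" if X: "X \<notin> B1 \<union> B2" for X
      unfolding Ev_def
    proof (clarify)
      fix lam y assume y: "second_eigenvalue (2 * s) (sym_mat X) lam" "is_eigvec (2 * s) (sym_mat X) lam y"
        "dotp (2 * s) y y = 1" "dotp (2 * s) y (u_vec s) \<ge> 0"
      have noise: "(\<lambda>i j. sym_mat X i j - bandM s p i j) = noise X"
        by (simp add: noise_def[abs_def])
      have "frob n (\<lambda>i j. \<Sum>k=1..n. noise X i k * noise X j k) \<le> nr ^ 3 + nr\<^sup>2 * x\<^sup>2"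
        unfolding nr_def by (rule frob_square_noise) (use X in \<open>force simp: B1_def\<close>)
      \<comment> \<open>The diagonal term takes at most half of \<eta>^4 n^4 and the off-diagonal
        term a quarter.\<close>
      also have "\<dots> \<le> (\<eta> * nr) ^ 4"
      proof -
        have "2 / \<eta> ^ 4 \<le> nr" using big nr by linarith
        then have "2 \<le> \<eta> ^ 4 * nr" using \<eta> by (simp add: field_simps)
        then have "nr ^ 3 * 2 \<le> nr ^ 3 * (\<eta> ^ 4 * nr)" using nr by (intro mult_left_mono) auto
        moreover have "nr\<^sup>2 * x\<^sup>2 = \<eta> ^ 4 * nr ^ 4 / 4" by (simp add: x_def eval_nat_numeral)
        moreover have "nr ^ 3 * (\<eta> ^ 4 * nr) = \<eta> ^ 4 * nr ^ 4" by (simp add: eval_nat_numeral)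
        moreover have "0 \<le> \<eta> ^ 4 * nr ^ 4" by simp
        ultimately show ?thesis unfolding power_mult_distrib by linarith
      qed
      finally have "\<bar>dotp n z (mulv n (noise X) z)\<bar> \<le> \<eta> * nr * dotp n z z" for z
        using nr \<eta> by (intro form_via_square noise_sym) auto
      moreover have "\<eta> * nr = p * real s / 100" by (simp add: \<eta>_def nr)
      ultimately have E_le: "\<bar>dotp (2 * s) z (mulv (2 * s) (\<lambda>i j. sym_mat X i j - bandM s p i j) z)\<bar>
          \<le> p * real s / 100 * dotp (2 * s) z z" for z
        by (simp only: noise n_def[symmetric])
      have Eu: "dotp (2 * s) (mulv (2 * s) (\<lambda>i j. sym_mat X i j - bandM s p i j) (u_unit s))
          (mulv (2 * s) (\<lambda>i j. sym_mat X i j - bandM s p i j) (u_unit s)) \<le> 4 * sq_tail * real n"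
        using X by (simp add: noise n_def[symmetric] B2_def)
      have "dotp (2 * s) (\<lambda>i. y i - u_unit s i) (\<lambda>i. y i - u_unit s i)
          \<le> 8 * (4 * sq_tail * real n) / (p * real s / 50)\<^sup>2"
        by (rule second_eigvec_close[OF s p(1) sym_mat_sym E_le Eu y])
      \<comment> \<open>Substituting s = n / 2 gives (p s / 50)^2 = p^2 n^2 / 10000, and 8 * 4 *
        10000 = 320000.\<close>
      also have "\<dots> = G / real (2 * s)"
        using s p by (simp add: G_def n_def power2_eq_square field_simps)
      finally show "dotp (2 * s) (\<lambda>i. y i - u_unit s i) (\<lambda>i. y i - u_unit s i) \<le> G / real (2 * s)" .
    qed
    have "1 - nr powr (-3) \<le> 1 - measure_pmf.prob Q (B1 \<union> B2)" using bad by simp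
    also have "\<dots> = measure_pmf.prob Q (UNIV - (B1 \<union> B2))"
      using measure_pmf.prob_compl[of "B1 \<union> B2" Q] by simp
    also have "\<dots> \<le> measure_pmf.prob Q (sym_mat -` Ev)"
      by (rule measure_pmf.finite_measure_mono) (use good in auto)
    also have "\<dots> = measure_pmf.prob (rand_sym (2 * s) (bandM s p)) Ev"
      using rand_sym_eq by (simp add: n_def)
    finally show "1 - real (2 * s) powr (-3) \<le> measure_pmf.prob (rand_sym (2 * s) (bandM s p)) Ev"
      by (simp only: nr_def n_def)
  qed
qed

theorem theorem3:
  fixes p \<beta> :: real
  assumes "0 < p" and "p < 1" and "0 \<le> \<beta>"
  shows "\<exists>C > 0. \<forall>s :: nat. s \<ge> 1 \<longrightarrow>
    measure_pmf.prob (rand_sym (2 * s) (bandM s p))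
      {A. \<forall>lam y. second_eigenvalue (2 * s) A lam \<and> is_eigvec (2 * s) A lam y \<and>
                  (\<Sum>i=1..2 * s. (y i)\<^sup>2) = 1 \<and> (\<Sum>i=1..2 * s. y i * u_vec s i) \<ge> 0 \<longrightarrow>
                  real (D_count (2 * s) (real (2 * s) powr \<beta>) 1 y)
                    < C * real (2 * s) powr ((7 - 2 * \<beta>) / 3)}
    \<ge> 1 - real (2 * s) powr (-3)"
proof (cases "\<beta> < 1")
  case False
  show ?thesis
  proof (intro exI[of _ 1] conjI allI impI)
    fix s :: nat assume "s \<ge> 1"
    then have "real (D_count (2 * s) (real (2 * s) powr \<beta>) 1 y) < 1 * real (2 * s) powr ((7 - 2 * \<beta>) / 3)" for y
      using False by (subst D_count_far) auto
    then show "1 - real (2 * s) powr (-3) \<le> measure_pmf.prob (rand_sym (2 * s) (bandM s p))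
      {A. \<forall>lam y. second_eigenvalue (2 * s) A lam \<and> is_eigvec (2 * s) A lam y \<and>
                  (\<Sum>i=1..2 * s. (y i)\<^sup>2) = 1 \<and> (\<Sum>i=1..2 * s. y i * u_vec s i) \<ge> 0 \<longrightarrow>
                  real (D_count (2 * s) (real (2 * s) powr \<beta>) 1 y)
                    < 1 * real (2 * s) powr ((7 - 2 * \<beta>) / 3)}"
      by simp
  qed simp
next
  case True
  define G where "G = 320000 * sq_tail / p\<^sup>2"
  obtain S where S: "\<And>s. s \<ge> S \<Longrightarrow> measure_pmf.prob (rand_sym (2 * s) (bandM s p))
      {A. \<forall>lam y. second_eigenvalue (2 * s) A lam \<and> is_eigvec (2 * s) A lam y \<and>
            dotp (2 * s) y y = 1 \<and> dotp (2 * s) y (u_vec s) \<ge> 0 \<longrightarrow>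
            dotp (2 * s) (\<lambda>i. y i - u_unit s i) (\<lambda>i. y i - u_unit s i) \<le> G / real (2 * s)}
      \<ge> 1 - real (2 * s) powr (-3)"
    using second_eigvec_close_whp[OF assms(1,2)] unfolding G_def by blast
  \<comment> \<open>The last summand covers all \<open>s < S\<close> through the trivial bound n^2;
    4 in place of 3 makes the inequality strict, and the absolute value keeps \<open>C\<close>
    positive without knowing the sign of \<open>G\<close>.\<close>
  define C where "C = 4 + 512 * \<bar>G\<bar> + (real (2 * S))\<^sup>2"
  have C: "C > 0" by (simp add: C_def add_pos_nonneg)
  show ?thesis
  proof (intro exI[of _ C] conjI allI impI C)
    fix s :: nat assume s: "s \<ge> 1"
    define Z where "Z = real (2 * s) powr ((7 - 2 * \<beta>) / 3)"
    have Z: "1 \<le> Z" unfolding Z_def using s True by (intro ge_one_powr_ge_zero) auto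
    define Ev where "Ev = {A. \<forall>lam y. second_eigenvalue (2 * s) A lam \<and> is_eigvec (2 * s) A lam y \<and>
                  (\<Sum>i=1..2 * s. (y i)\<^sup>2) = 1 \<and> (\<Sum>i=1..2 * s. y i * u_vec s i) \<ge> 0 \<longrightarrow>
                  real (D_count (2 * s) (real (2 * s) powr \<beta>) 1 y) < C * Z}"
    have "1 - real (2 * s) powr (-3) \<le> measure_pmf.prob (rand_sym (2 * s) (bandM s p)) Ev"
    proof (cases "s \<ge> S")
      case False
      have "real (D_count (2 * s) k 1 y) < C * Z" for k y
      proof -
        have "real (D_count (2 * s) k 1 y) \<le> (real (2 * s))\<^sup>2" by (rule D_count_trivial)
        also have "\<dots> \<le> (real (2 * S))\<^sup>2" using False by (intro power_mono) auto
        also have "\<dots> < C" by (simp add: C_def add_pos_nonneg)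
        also have "\<dots> \<le> C * Z" using Z C by simp
        finally show ?thesis .
      qed
      then have "Ev = UNIV" by (simp add: Ev_def)
      then show ?thesis by simp
    next
      case True
      note S[OF True]
      also have "measure_pmf.prob (rand_sym (2 * s) (bandM s p))
        {A. \<forall>lam y. second_eigenvalue (2 * s) A lam \<and> is_eigvec (2 * s) A lam y \<and>
            dotp (2 * s) y y = 1 \<and> dotp (2 * s) y (u_vec s) \<ge> 0 \<longrightarrow>
            dotp (2 * s) (\<lambda>i. y i - u_unit s i) (\<lambda>i. y i - u_unit s i) \<le> G / real (2 * s)}
        \<le> measure_pmf.prob (rand_sym (2 * s) (bandM s p)) Ev"
      proof (rule measure_pmf.finite_measure_mono)
        have "real (D_count (2 * s) (real (2 * s) powr \<beta>) 1 y) < C * Z"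
          if "dotp (2 * s) (\<lambda>i. y i - u_unit s i) (\<lambda>i. y i - u_unit s i) \<le> G / real (2 * s)" for y
        proof -
          have "real (D_count (2 * s) (real (2 * s) powr \<beta>) 1 y) \<le> (3 + 512 * G) * Z"
            unfolding Z_def by (rule D_count_bound[OF s assms(3) \<open>\<beta> < 1\<close> that])
          also have "\<dots> < C * Z"
          proof (rule mult_strict_right_mono)
            show "3 + 512 * G < C"
              using abs_ge_self[of G] zero_le_power2[of "real (2 * S)"] unfolding C_def by linarith
          qed (use Z in simp)
          finally show ?thesis .
        qed
        then show "{A. \<forall>lam y. second_eigenvalue (2 * s) A lam \<and> is_eigvec (2 * s) A lam y \<and>
            dotp (2 * s) y y = 1 \<and> dotp (2 * s) y (u_vec s) \<ge> 0 \<longrightarrow>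
            dotp (2 * s) (\<lambda>i. y i - u_unit s i) (\<lambda>i. y i - u_unit s i) \<le> G / real (2 * s)} \<subseteq> Ev"
          unfolding Ev_def dotp_self[of _ "y" for y] by (auto simp: dotp_def power2_eq_square)
      qed simp
      finally show ?thesis .
    qed
    then show "1 - real (2 * s) powr (-3) \<le> measure_pmf.prob (rand_sym (2 * s) (bandM s p))
      {A. \<forall>lam y. second_eigenvalue (2 * s) A lam \<and> is_eigvec (2 * s) A lam y \<and>
                  (\<Sum>i=1..2 * s. (y i)\<^sup>2) = 1 \<and> (\<Sum>i=1..2 * s. y i * u_vec s i) \<ge> 0 \<longrightarrow>
                  real (D_count (2 * s) (real (2 * s) powr \<beta>) 1 y)
                    < C * real (2 * s) powr ((7 - 2 * \<beta>) / 3)}"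
      unfolding Ev_def Z_def .
  qed
qed

end
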